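(* Let $\mathfrak{B}\in\mathcal{U}^*$ and let $\pi:\mathfrak{A}\to\mathfrak{B}$ be a finite covering map. Then $\pi$ is strongly split.
   Context: $\mathcal{U}^*$ is the class of at most countable structures $\mathfrak{B}$ that are first-order interdefinable with a structure whose signature consists of finitely many unary relation symbols, and such that every orbit of $\mathrm{Aut}(\mathfrak{B})$ on the domain $B$ is a singleton or infinite. (Two structures on the same domain are interdefinable if each is a first-order reduct of the other; a first-order reduct of $\mathfrak{A}$ is a relational structure on the same domain whose relations are all first-order definable without parameters in $\mathfrak{A}$.) For a map $\pi:A\to B$ let $\sim_\pi=\{(a_1,a_2)\in A^2:\pi(a_1)=\pi(a_2)\}$. If $\pi$ is surjective and a permutation group $G$ on $A$ preserves $\sim_\pi$, let $\mu_\pi:G\to\mathrm{Sym}(B)$ be the homomorphism with $\mu_\pi(g)(\pi(a))=\pi(g(a))$. A map $\pi:A\to B$ between the domains of structures $\mathfrak{A},\mathfrak{B}$ is a finite covering map (finite cover) $\pi:\mathfrak{A}\to\mathfrak{B}$ if it is surjective, every fiber $\pi^{-1}(b)$ is finite, $\mathrm{Aut}(\mathfrak{A})$ preserves $\sim_\pi$, and $\mu_\pi(\mathrm{Aut}(\mathfrak{A}))=\mathrm{Aut}(\mathfrak{B})$. The fiber group of $\pi$ at $b\in B$ is the permutation group on $S=\pi^{-1}(b)$ induced by the setwise stabiliser of $S$ in $\mathrm{Aut}(\mathfrak{A})$. A finite cover is strongly trivial if all its fiber groups are trivial. Given a finite cover $\pi:\mathfrak{A}'\to\mathfrak{B}$,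 a first-order reduct $\mathfrak{C}$ of $\mathfrak{A}'$ is a covering reduct of $\mathfrak{A}'$ with respect to $\pi$ if every $\alpha\in\mathrm{Aut}(\mathfrak{C})$ preserves $\sim_\pi$ and satisfies $\mu_\pi(\alpha)\in\mathrm{Aut}(\mathfrak{B})$. A finite cover $\pi:\mathfrak{A}\to\mathfrak{B}$ is strongly split if there is a structure $\mathfrak{A}'$ on the domain $A$ such that $\pi:\mathfrak{A}'\to\mathfrak{B}$ is a strongly trivial finite cover and $\mathfrak{A}$ is a covering reduct of $\mathfrak{A}'$ with respect to $\pi$. *)

theory Defs
  imports "HOL-Library.Countable_Set" "HOL-Combinatorics.Orbits"
begin

section \<open>Relational structures and first-order definability\<close>

text \<open>
  The domain and the signature are explicit sets inside the types of the record. The fields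
  \<open>arity\<close> and \<open>interp\<close> are only meaningful on \<open>symbols\<close>. Empty domains and nullary symbols
  are permitted.
\<close>

record ('a, 's) rstruct =
  universe :: "'a set"
  symbols :: "'s set"
  arity :: "'s \<Rightarrow> nat"
  interp :: "'s \<Rightarrow> 'a list set"

definition tuples :: "'a set \<Rightarrow> nat \<Rightarrow> 'a list set" where
  "tuples A n = {xs. length xs = n \<and> set xs \<subseteq> A}"

definition is_structure :: "('a, 's) rstruct \<Rightarrow> bool" where
  "is_structure \<AA> \<longleftrightarrow>
     (\<forall>s \<in> symbols \<AA>. interp \<AA> s \<subseteq> tuples (universe \<AA>) (arity \<AA> s))"

datatype 's fm =
    Eq nat nat
  | Atom 's "nat list"
  | Neg "'s fm"
  | Conj "'s fm" "'s fm"
  | Exi nat "'s fm"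

fun sat :: "('a, 's) rstruct \<Rightarrow> (nat \<Rightarrow> 'a) \<Rightarrow> 's fm \<Rightarrow> bool" where
  "sat \<AA> e (Eq x y) \<longleftrightarrow> e x = e y"
| "sat \<AA> e (Atom s xs) \<longleftrightarrow> map e xs \<in> interp \<AA> s"
| "sat \<AA> e (Neg \<phi>) \<longleftrightarrow> \<not> sat \<AA> e \<phi>"
| "sat \<AA> e (Conj \<phi> \<psi>) \<longleftrightarrow> sat \<AA> e \<phi> \<and> sat \<AA> e \<psi>"
| "sat \<AA> e (Exi x \<phi>) \<longleftrightarrow> (\<exists>a \<in> universe \<AA>. sat \<AA> (e(x := a)) \<phi>)"

fun free_vars :: "'s fm \<Rightarrow> nat set" where
  "free_vars (Eq x y) = {x, y}"
| "free_vars (Atom s xs) = set xs"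
| "free_vars (Neg \<phi>) = free_vars \<phi>"
| "free_vars (Conj \<phi> \<psi>) = free_vars \<phi> \<union> free_vars \<psi>"
| "free_vars (Exi x \<phi>) = free_vars \<phi> - {x}"

fun wf_fm :: "('a, 's) rstruct \<Rightarrow> 's fm \<Rightarrow> bool" where
  "wf_fm \<AA> (Eq x y) \<longleftrightarrow> True"
| "wf_fm \<AA> (Atom s xs) \<longleftrightarrow> s \<in> symbols \<AA> \<and> length xs = arity \<AA> s"
| "wf_fm \<AA> (Neg \<phi>) \<longleftrightarrow> wf_fm \<AA> \<phi>"
| "wf_fm \<AA> (Conj \<phi> \<psi>) \<longleftrightarrow> wf_fm \<AA> \<phi> \<and> wf_fm \<AA> \<psi>"
| "wf_fm \<AA> (Exi x \<phi>) \<longleftrightarrow> wf_fm \<AA> \<phi>"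

text \<open>
  A defining formula of an \<open>n\<close>-ary relation has its free variables among \<open>0, \<dots>, n - 1\<close>, so the
  values of the valuation \<open>(!) xs\<close> at indices \<open>\<ge> n\<close> are irrelevant
  (see \<open>sat_cong\<close>).
\<close>

definition fo_definable :: "('a, 's) rstruct \<Rightarrow> nat \<Rightarrow> 'a list set \<Rightarrow> bool" where
  "fo_definable \<AA> n R \<longleftrightarrow>
     (\<exists>\<phi>. wf_fm \<AA> \<phi> \<and> free_vars \<phi> \<subseteq> {..<n} \<and>
          R = {xs \<in> tuples (universe \<AA>) n. sat \<AA> ((!) xs) \<phi>})"

definition fo_reduct :: "('a, 's) rstruct \<Rightarrow> ('a, 't) rstruct \<Rightarrow> bool" where
  "fo_reduct \<CC> \<AA> \<longleftrightarrow>
     is_structure \<CC> \<and> is_structure \<AA> \<and> universe \<CC> = universe \<AA> \<and>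
     (\<forall>s \<in> symbols \<CC>. fo_definable \<AA> (arity \<CC> s) (interp \<CC> s))"

definition interdefinable :: "('a, 's) rstruct \<Rightarrow> ('a, 't) rstruct \<Rightarrow> bool" where
  "interdefinable \<AA> \<BB> \<longleftrightarrow> fo_reduct \<AA> \<BB> \<and> fo_reduct \<BB> \<AA>"

section \<open>Automorphisms and the class \<open>\<U>\<^sup>*\<close>\<close>

text \<open>
  Permutations of a set \<open>A\<close> are total functions that are the identity outside \<open>A\<close>, as in the
  library notion \<open>permutes\<close> (here also used for infinite \<open>A\<close>).
\<close>

definition Aut :: "('a, 's) rstruct \<Rightarrow> ('a \<Rightarrow> 'a) set" where
  "Aut \<AA> = {g. g permutes universe \<AA> \<and>
     (\<forall>s \<in> symbols \<AA>. \<forall>xs \<in> tuples (universe \<AA>) (arity \<AA> s).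
        map g xs \<in> interp \<AA> s \<longleftrightarrow> xs \<in> interp \<AA> s)}"

definition aut_orbit :: "('a, 's) rstruct \<Rightarrow> 'a \<Rightarrow> 'a set" where
  "aut_orbit \<AA> a = {g a | g. g \<in> Aut \<AA>}"

definition finite_unary_structure :: "('a, 's) rstruct \<Rightarrow> bool" where
  "finite_unary_structure \<DD> \<longleftrightarrow>
     is_structure \<DD> \<and> finite (symbols \<DD>) \<and> (\<forall>s \<in> symbols \<DD>. arity \<DD> s = 1)"

text \<open>
  The symbols of the unary structure are drawn from \<open>nat\<close>; since the signature is finite this is
  no restriction (see \<open>U_starI\<close>).
\<close>

definition U_star :: "('b, 's) rstruct set" where
  "U_star = {\<BB>. is_structure \<BB> \<and> countable (universe \<BB>) \<and>
     (\<exists>\<DD> :: ('b, nat) rstruct. finite_unary_structure \<DD> \<and> interdefinable \<BB> \<DD>) \<and>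
     (\<forall>b \<in> universe \<BB>. is_singleton (aut_orbit \<BB> b) \<or> infinite (aut_orbit \<BB> b))}"

section \<open>Finite covers\<close>

definition fiber_eq :: "('a \<Rightarrow> 'b) \<Rightarrow> 'a set \<Rightarrow> 'a rel" where
  "fiber_eq \<pi> A = {(a1, a2). a1 \<in> A \<and> a2 \<in> A \<and> \<pi> a1 = \<pi> a2}"

definition preserves_rel :: "('a \<Rightarrow> 'a) \<Rightarrow> 'a rel \<Rightarrow> bool" where
  "preserves_rel g E \<longleftrightarrow> (\<forall>(a1, a2) \<in> E. (g a1, g a2) \<in> E)"

text \<open>
  The map \<open>\<mu>\<^sub>\<pi>\<close>, for \<open>\<pi>\<close> onto \<open>B\<close>. A preimage is chosen, but for \<open>g\<close> preserving \<open>fiber_eq \<pi> A\<close>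
  the result does not depend on it (see \<open>mu_apply\<close>). Values at other \<open>g\<close> are never used.
\<close>

definition mu :: "('a \<Rightarrow> 'b) \<Rightarrow> 'a set \<Rightarrow> 'b set \<Rightarrow> ('a \<Rightarrow> 'a) \<Rightarrow> ('b \<Rightarrow> 'b)" where
  "mu \<pi> A B g = (\<lambda>b. if b \<in> B then \<pi> (g (inv_into A \<pi> b)) else b)"

definition fiber :: "('a \<Rightarrow> 'b) \<Rightarrow> 'a set \<Rightarrow> 'b \<Rightarrow> 'a set" where
  "fiber \<pi> A b = {a \<in> A. \<pi> a = b}"

definition finite_cover :: "('a \<Rightarrow> 'b) \<Rightarrow> ('a, 'r) rstruct \<Rightarrow> ('b, 's) rstruct \<Rightarrow> bool" where
  "finite_cover \<pi> \<AA> \<BB> \<longleftrightarrow>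
     is_structure \<AA> \<and> is_structure \<BB> \<and>
     \<pi> ` universe \<AA> = universe \<BB> \<and>
     (\<forall>b \<in> universe \<BB>. finite (fiber \<pi> (universe \<AA>) b)) \<and>
     (\<forall>g \<in> Aut \<AA>. preserves_rel g (fiber_eq \<pi> (universe \<AA>))) \<and>
     mu \<pi> (universe \<AA>) (universe \<BB>) ` Aut \<AA> = Aut \<BB>"

definition fiber_group :: "('a \<Rightarrow> 'b) \<Rightarrow> ('a, 'r) rstruct \<Rightarrow> 'b \<Rightarrow> ('a \<Rightarrow> 'a) set" where
  "fiber_group \<pi> \<AA> b =
     (let S = fiber \<pi> (universe \<AA>) b in {perm_restrict g S | g. g \<in> Aut \<AA> \<and> g ` S = S})"

definition strongly_trivial_cover ::
    "('a \<Rightarrow> 'b) \<Rightarrow> ('a, 'r) rstruct \<Rightarrow> ('b, 's) rstruct \<Rightarrow> bool" where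
  "strongly_trivial_cover \<pi> \<AA> \<BB> \<longleftrightarrow>
     finite_cover \<pi> \<AA> \<BB> \<and> (\<forall>b \<in> universe \<BB>. fiber_group \<pi> \<AA> b = {id})"

text \<open>\<open>\<CC>\<close> is a covering reduct of \<open>\<AA>'\<close> with respect to the finite cover \<open>\<pi> : \<AA>' \<rightarrow> \<BB>\<close>.\<close>

definition covering_reduct ::
    "('a \<Rightarrow> 'b) \<Rightarrow> ('a, 'q) rstruct \<Rightarrow> ('a, 'r) rstruct \<Rightarrow> ('b, 's) rstruct \<Rightarrow> bool" where
  "covering_reduct \<pi> \<CC> \<AA>' \<BB> \<longleftrightarrow>
     finite_cover \<pi> \<AA>' \<BB> \<and> fo_reduct \<CC> \<AA>' \<and>
     (\<forall>\<alpha> \<in> Aut \<CC>. preserves_rel \<alpha> (fiber_eq \<pi> (universe \<CC>)) \<and>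
        mu \<pi> (universe \<CC>) (universe \<BB>) \<alpha> \<in> Aut \<BB>)"

text \<open>
  HOL cannot quantify over the type of symbols of \<open>\<AA>'\<close>. The type \<open>nat \<times> 'a list set\<close> is large
  enough: a structure of any signature can be re-indexed by using each pair (arity, relation) as
  its own symbol, which changes neither the automorphisms nor the reducts
  (see \<open>strongly_splitI\<close>).
\<close>

definition strongly_split ::
    "('a \<Rightarrow> 'b) \<Rightarrow> ('a, 'r) rstruct \<Rightarrow> ('b, 's) rstruct \<Rightarrow> bool" where
  "strongly_split \<pi> \<AA> \<BB> \<longleftrightarrow>
     finite_cover \<pi> \<AA> \<BB> \<and>
     (\<exists>\<AA>' :: ('a, nat \<times> 'a list set) rstruct.
        universe \<AA>' = universe \<AA> \<and> strongly_trivial_cover \<pi> \<AA>' \<BB> \<and>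
        covering_reduct \<pi> \<AA> \<AA>' \<BB>)"

section \<open>Justification of the encodings\<close>

lemma sat_cong:
  "(\<And>x. x \<in> free_vars \<phi> \<Longrightarrow> e x = e' x) \<Longrightarrow> sat \<AA> e \<phi> \<longleftrightarrow> sat \<AA> e' \<phi>"
proof (induction \<phi> arbitrary: e e')
  case (Eq x y)
  then have "e x = e' x" "e y = e' y" by simp_all
  then show ?case by simp
next
  case (Atom s xs)
  then have "map e xs = map e' xs" by simp
  then show ?case by (simp only: sat.simps)
next
  case (Neg \<phi>)
  have "sat \<AA> e \<phi> \<longleftrightarrow> sat \<AA> e' \<phi>" using Neg.prems by (intro Neg.IH) simp
  then show ?case by simp
next
  case (Conj \<phi> \<psi>)
  have "sat \<AA> e \<phi> \<longleftrightarrow> sat \<AA> e' \<phi>" "sat \<AA> e \<psi> \<longleftrightarrow> sat \<AA> e' \<psi>"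
    using Conj.prems by (intro Conj.IH; simp)+
  then show ?case by simp
next
  case (Exi x \<phi>)
  have "sat \<AA> (e(x := a)) \<phi> \<longleftrightarrow> sat \<AA> (e'(x := a)) \<phi>" for a
    using Exi.prems by (intro Exi.IH) auto
  then show ?case by simp
qed

lemma mu_apply:
  assumes "\<pi> ` A = B" and "preserves_rel g (fiber_eq \<pi> A)" and "a \<in> A"
  shows "mu \<pi> A B g (\<pi> a) = \<pi> (g a)"
proof -
  have "(inv_into A \<pi> (\<pi> a), a) \<in> fiber_eq \<pi> A"
    using assms(3) by (simp add: fiber_eq_def inv_into_into f_inv_into_f)
  then have "(g (inv_into A \<pi> (\<pi> a)), g a) \<in> fiber_eq \<pi> A"
    using assms(2) by (auto simp: preserves_rel_def)
  moreover have "\<pi> a \<in> B" using assms(1,3) by blast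
  ultimately show ?thesis by (simp add: mu_def fiber_eq_def)
qed

definition reindexed :: "('a, 's) rstruct \<Rightarrow> ('a, 't) rstruct \<Rightarrow> bool" where
  "reindexed \<AA> \<AA>' \<longleftrightarrow> universe \<AA> = universe \<AA>' \<and>
     (\<exists>f. symbols \<AA>' = f ` symbols \<AA> \<and>
       (\<forall>s \<in> symbols \<AA>. arity \<AA>' (f s) = arity \<AA> s \<and> interp \<AA>' (f s) = interp \<AA> s))"

lemma reindexed_is_structure:
  assumes "reindexed \<AA> \<AA>'"
  shows "is_structure \<AA>' \<longleftrightarrow> is_structure \<AA>"
proof -
  obtain f where f: "symbols \<AA>' = f ` symbols \<AA>"
    "\<forall>s \<in> symbols \<AA>. arity \<AA>' (f s) = arity \<AA> s \<and> interp \<AA>' (f s) = interp \<AA> s"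
    and u: "universe \<AA>' = universe \<AA>"
    using assms by (auto simp: reindexed_def)
  show ?thesis by (simp add: is_structure_def f u)
qed

lemma reindexed_Aut:
  assumes "reindexed \<AA> \<AA>'"
  shows "Aut \<AA>' = Aut \<AA>"
proof -
  obtain f where f: "symbols \<AA>' = f ` symbols \<AA>"
    "\<forall>s \<in> symbols \<AA>. arity \<AA>' (f s) = arity \<AA> s \<and> interp \<AA>' (f s) = interp \<AA> s"
    and u: "universe \<AA>' = universe \<AA>"
    using assms by (auto simp: reindexed_def)
  show ?thesis by (simp add: Aut_def f u)
qed

lemma map_fm_transfer:
  assumes "universe \<AA> = universe \<AA>'"
    and "\<And>s. s \<in> symbols \<AA> \<Longrightarrow>
      h s \<in> symbols \<AA>' \<and> arity \<AA>' (h s) = arity \<AA> s \<and> interp \<AA>' (h s) = interp \<AA> s"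
  shows "wf_fm \<AA> \<phi> \<Longrightarrow>
    wf_fm \<AA>' (map_fm h \<phi>) \<and> free_vars (map_fm h \<phi>) = free_vars \<phi> \<and>
    (\<forall>e. sat \<AA>' e (map_fm h \<phi>) \<longleftrightarrow> sat \<AA> e \<phi>)"
  using assms by (induction \<phi>) auto

lemma fo_definable_transfer:
  assumes "universe \<AA> = universe \<AA>'"
    and "\<And>s. s \<in> symbols \<AA> \<Longrightarrow>
      h s \<in> symbols \<AA>' \<and> arity \<AA>' (h s) = arity \<AA> s \<and> interp \<AA>' (h s) = interp \<AA> s"
    and "fo_definable \<AA> n R"
  shows "fo_definable \<AA>' n R"
proof -
  obtain \<phi> where \<phi>: "wf_fm \<AA> \<phi>" "free_vars \<phi> \<subseteq> {..<n}"
    "R = {xs \<in> tuples (universe \<AA>) n. sat \<AA> ((!) xs) \<phi>}"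
    using assms(3) by (auto simp: fo_definable_def)
  note t = map_fm_transfer[where h = h, OF assms(1,2) \<phi>(1)]
  show ?thesis unfolding fo_definable_def
    using t \<phi> assms(1) by (intro exI[of _ "map_fm h \<phi>"]) auto
qed

lemma reindexed_fo_definable:
  assumes "reindexed \<AA> \<AA>'"
  shows "fo_definable \<AA>' n R \<longleftrightarrow> fo_definable \<AA> n R"
proof -
  obtain f where f: "symbols \<AA>' = f ` symbols \<AA>"
    "\<And>s. s \<in> symbols \<AA> \<Longrightarrow> arity \<AA>' (f s) = arity \<AA> s \<and> interp \<AA>' (f s) = interp \<AA> s"
    and u: "universe \<AA> = universe \<AA>'"
    using assms by (auto simp: reindexed_def)
  let ?h = "inv_into (symbols \<AA>) f"
  have h: "?h t \<in> symbols \<AA> \<and> arity \<AA> (?h t) = arity \<AA>' t \<and> interp \<AA> (?h t) = interp \<AA>' t"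
    if "t \<in> symbols \<AA>'" for t
    using that f by (metis f_inv_into_f inv_into_into)
  show ?thesis
    using fo_definable_transfer[where h = f and \<AA> = \<AA> and \<AA>' = \<AA>', OF u]
      fo_definable_transfer[where h = ?h and \<AA> = \<AA>' and \<AA>' = \<AA>, OF u[symmetric]] f h
    by blast
qed

lemma reindexed_universe: "reindexed \<AA> \<AA>' \<Longrightarrow> universe \<AA>' = universe \<AA>"
  by (simp add: reindexed_def)

lemma reindexed_fo_reduct_left:
  assumes "reindexed \<AA> \<AA>'"
  shows "fo_reduct \<AA>' \<CC> \<longleftrightarrow> fo_reduct \<AA> \<CC>"
proof -
  obtain f where f: "symbols \<AA>' = f ` symbols \<AA>"
    "\<forall>s \<in> symbols \<AA>. arity \<AA>' (f s) = arity \<AA> s \<and> interp \<AA>' (f s) = interp \<AA> s"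
    using assms by (auto simp: reindexed_def)
  then have "(\<forall>t \<in> symbols \<AA>'. fo_definable \<CC> (arity \<AA>' t) (interp \<AA>' t)) \<longleftrightarrow>
      (\<forall>s \<in> symbols \<AA>. fo_definable \<CC> (arity \<AA> s) (interp \<AA> s))"
    by simp
  then show ?thesis
    by (simp add: fo_reduct_def reindexed_is_structure[OF assms] reindexed_universe[OF assms])
qed

lemma reindexed_fo_reduct_right:
  assumes "reindexed \<AA> \<AA>'"
  shows "fo_reduct \<CC> \<AA>' \<longleftrightarrow> fo_reduct \<CC> \<AA>"
  by (simp add: fo_reduct_def reindexed_is_structure[OF assms] reindexed_universe[OF assms]
      reindexed_fo_definable[OF assms])

lemma U_starI:
  fixes \<BB> :: "('b, 's) rstruct" and \<DD> :: "('b, 't) rstruct"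
  assumes "is_structure \<BB>" "countable (universe \<BB>)"
    and "finite_unary_structure \<DD>" "interdefinable \<BB> \<DD>"
    and "\<And>b. b \<in> universe \<BB> \<Longrightarrow> is_singleton (aut_orbit \<BB> b) \<or> infinite (aut_orbit \<BB> b)"
  shows "\<BB> \<in> U_star"
proof -
  obtain f :: "'t \<Rightarrow> nat" where f: "inj_on f (symbols \<DD>)"
    using assms(3) finite_imp_inj_to_nat_seg unfolding finite_unary_structure_def by metis
  let ?g = "inv_into (symbols \<DD>) f"
  define \<DD>' :: "('b, nat) rstruct" where
    "\<DD>' = \<lparr>universe = universe \<DD>, symbols = f ` symbols \<DD>,
            arity = arity \<DD> \<circ> ?g, interp = interp \<DD> \<circ> ?g\<rparr>"
  have r: "reindexed \<DD> \<DD>'"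
    using f by (auto simp: reindexed_def \<DD>'_def intro!: exI[of _ f])
  have "finite_unary_structure \<DD>'"
    using assms(3) f reindexed_is_structure[OF r]
    by (auto simp: finite_unary_structure_def \<DD>'_def)
  moreover have "interdefinable \<BB> \<DD>'"
    using assms(4)
    by (simp add: interdefinable_def reindexed_fo_reduct_left[OF r] reindexed_fo_reduct_right[OF r])
  ultimately show ?thesis using assms(1,2,5) by (auto simp: U_star_def)
qed

lemma reindexed_finite_cover:
  assumes "reindexed \<AA> \<AA>'"
  shows "finite_cover \<pi> \<AA>' \<BB> \<longleftrightarrow> finite_cover \<pi> \<AA> \<BB>"
  by (simp add: finite_cover_def reindexed_is_structure[OF assms] reindexed_universe[OF assms]
      reindexed_Aut[OF assms])

lemma reindexed_fiber_group:
  assumes "reindexed \<AA> \<AA>'"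
  shows "fiber_group \<pi> \<AA>' b = fiber_group \<pi> \<AA> b"
  by (simp add: fiber_group_def reindexed_universe[OF assms] reindexed_Aut[OF assms])

lemma strongly_splitI:
  fixes \<AA> :: "('a, 'r) rstruct" and \<AA>' :: "('a, 't) rstruct" and \<BB> :: "('b, 's) rstruct"
  assumes "finite_cover \<pi> \<AA> \<BB>" "universe \<AA>' = universe \<AA>"
    and "strongly_trivial_cover \<pi> \<AA>' \<BB>" "covering_reduct \<pi> \<AA> \<AA>' \<BB>"
  shows "strongly_split \<pi> \<AA> \<BB>"
proof -
  define \<AA>'' :: "('a, nat \<times> 'a list set) rstruct" where
    "\<AA>'' = \<lparr>universe = universe \<AA>', symbols = (\<lambda>s. (arity \<AA>' s, interp \<AA>' s)) ` symbols \<AA>',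
             arity = fst, interp = snd\<rparr>"
  have r: "reindexed \<AA>' \<AA>''"
    by (auto simp: reindexed_def \<AA>''_def intro!: exI[of _ "\<lambda>s. (arity \<AA>' s, interp \<AA>' s)"])
  have "strongly_trivial_cover \<pi> \<AA>'' \<BB>"
    using assms(3)
    by (simp add: strongly_trivial_cover_def reindexed_finite_cover[OF r] reindexed_fiber_group[OF r])
  moreover have "covering_reduct \<pi> \<AA> \<AA>'' \<BB>"
    using assms(4)
    by (simp add: covering_reduct_def reindexed_finite_cover[OF r] reindexed_fo_reduct_right[OF r])
  moreover have "universe \<AA>'' = universe \<AA>" using assms(2) by (simp add: \<AA>''_def)
  ultimately show ?thesis using assms(1) unfolding strongly_split_def by blast
qed

end

theory Submission
  imports Defs
begin

text \<open>
  A structure in \<open>\<U>\<^sup>*\<close> has the automorphism group of a coloured set: there are finitely many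
  colours (here called sorts), every sort has one element or infinitely many, and the
  automorphisms are all permutations that preserve the sorts. Write \<open>G\<close> for the automorphism group
  of the covering structure. It suffices to label the points of the cover so that the points of a
  fiber carry distinct labels and every sort-preserving permutation of the base has a lift in
  \<open>G\<close> that preserves labels (\<open>labels_exist\<close>). These lifts form a group \<open>L\<close>, and the
  structure of all \<open>L\<close>-invariant relations is the one required: a lift that maps a fiber to itself
  and preserves labels fixes the fiber pointwise, and every relation of the given structure is
  \<open>L\<close>-invariant because \<open>L \<subseteq> G\<close>.

  The labels are found as follows. First, constants cost little: fixing the points over a finite
  set \<open>Y\<close> does not restrict how finite sets in the rest of the base can move (\<open>stab_moves\<close>), because
  the lifts of the permutations fixing \<open>Y\<close> induce only finitely many permutations on the finitely
  many points over \<open>Y\<close>, so two of infinitely many lifts agree there; their quotient fixes the points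
  over \<open>Y\<close>, and conjugation turns it into whatever motion is wanted. Next, the finite group which
  the stabiliser of the points over \<open>Y\<close> induces on one more fiber can only shrink when \<open>Y\<close> grows, so it is
  constant from some finite \<open>Y\<close> on (\<open>steady_base\<close>). Beyond this \<open>Y\<close> the fibers are independent:
  every permutation that can be induced on one fiber can be induced there while any finite
  number of other fibers stay fixed. Label a fiber by transporting it, inside the stabiliser of the
  points over \<open>Y\<close>, to a reference fiber of its sort. An arbitrary lift of a permutation preserves
  these labels up to an error in each fiber, and by independence the errors can be removed one
  fiber at a time (\<open>coordinates_off_exist\<close>).

  This labels all fibers except the ones over \<open>Y\<close>. To reach those, embed the base into itself so
  that \<open>Y\<close> is avoided, except for the sorts of size one. As the base is countable, \<open>stab_moves\<close>
  approximates this embedding by a sequence in \<open>G\<close> that is eventually constant at every point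
  (\<open>approximate_embedding\<close>), and labels can be pulled back along it. Finally, \<open>G\<close> is closed under
  pointwise limits, so that label-preserving lifts on finite pieces give global ones.
\<close>

section \<open>Sort-preserving permutations\<close>

definition sort_perms :: "('b \<Rightarrow> 'k) \<Rightarrow> 'b set \<Rightarrow> ('b \<Rightarrow> 'b) set" where
  "sort_perms \<kappa> B = {q. q permutes B \<and> (\<forall>b \<in> B. \<kappa> (q b) = \<kappa> b)}"

lemma sort_perms_in: "q \<in> sort_perms \<kappa> B \<Longrightarrow> b \<in> B \<Longrightarrow> q b \<in> B"
  by (auto simp: sort_perms_def permutes_in_image)

lemma sort_perms_sort: "q \<in> sort_perms \<kappa> B \<Longrightarrow> b \<in> B \<Longrightarrow> \<kappa> (q b) = \<kappa> b"
  by (auto simp: sort_perms_def)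

lemma sort_perms_eq_iff: "q \<in> sort_perms \<kappa> B \<Longrightarrow> q b = q b' \<longleftrightarrow> b = b'"
  by (auto simp: sort_perms_def dest: permutes_inj injD)

lemma id_in_sort_perms: "id \<in> sort_perms \<kappa> B"
  by (auto simp: sort_perms_def permutes_id)

lemma comp_in_sort_perms:
  "p \<in> sort_perms \<kappa> B \<Longrightarrow> q \<in> sort_perms \<kappa> B \<Longrightarrow> p \<circ> q \<in> sort_perms \<kappa> B"
  by (auto simp: sort_perms_def permutes_compose permutes_in_image)

lemma inv_in_sort_perms:
  assumes "q \<in> sort_perms \<kappa> B"
  shows "inv q \<in> sort_perms \<kappa> B"
proof -
  have q: "q permutes B" "\<And>b. b \<in> B \<Longrightarrow> \<kappa> (q b) = \<kappa> b"
    using assms by (auto simp: sort_perms_def)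
  have "\<kappa> (inv q b) = \<kappa> b" if "b \<in> B" for b
    using q(2)[of "inv q b"] permutes_in_image[OF permutes_inv[OF q(1)], of b] that
      permutes_inverses(1)[OF q(1), of b] by simp
  then show ?thesis using permutes_inv[OF q(1)] by (auto simp: sort_perms_def)
qed

lemma transpose_in_sort_perms:
  assumes "a \<in> B" "b \<in> B" "\<kappa> a = \<kappa> b"
  shows "transpose a b \<in> sort_perms \<kappa> B"
  using assms by (auto simp: sort_perms_def permutes_swap_id transpose_def)

text \<open>
  The pairs \<open>(x i, y i)\<close> form a finite partial bijection. They are handled one at a time: a
  transposition in the sort of \<open>y i\<close> corrects the value at \<open>x i\<close> and affects neither \<open>Y\<close> nor the
  values treated before.
\<close>

lemma sort_perms_extend:
  assumes "finite I" and "inj_on x I" "inj_on y I"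
    and "x ` I \<subseteq> B - Y" "y ` I \<subseteq> B - Y" and "\<And>i. i \<in> I \<Longrightarrow> \<kappa> (x i) = \<kappa> (y i)"
  shows "\<exists>p \<in> sort_perms \<kappa> B. (\<forall>b \<in> Y. p b = b) \<and> (\<forall>i \<in> I. p (x i) = y i)"
  using assms
proof (induction I rule: finite_induct)
  case empty
  show ?case by (intro bexI[OF _ id_in_sort_perms]) simp
next
  case (insert i I)
  obtain p where p: "p \<in> sort_perms \<kappa> B" "\<forall>b \<in> Y. p b = b" "\<forall>i \<in> I. p (x i) = y i"
    using insert.IH insert.prems by auto
  have xy: "x i \<in> B - Y" "y i \<in> B - Y" "\<kappa> (x i) = \<kappa> (y i)" using insert.prems(3-5) by auto
  let ?p = "transpose (p (x i)) (y i) \<circ> p"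
  have "?p \<in> sort_perms \<kappa> B"
    using xy sort_perms_in[OF p(1)] sort_perms_sort[OF p(1)] p(1)
    by (intro comp_in_sort_perms transpose_in_sort_perms) auto
  moreover have "?p b = b" if "b \<in> Y" for b
  proof -
    have "p b \<noteq> p (x i)" using that xy(1) sort_perms_eq_iff[OF p(1)] by auto
    then show ?thesis using that p(2) xy(2) by (auto simp: transpose_def)
  qed
  moreover have "?p (x j) = y j" if "j \<in> I" for j
  proof -
    have "x j \<noteq> x i" "y j \<noteq> y i" using that insert.prems(1,2) insert.hyps(2) by (auto simp: inj_on_def)
    then have "p (x j) \<noteq> p (x i)" using sort_perms_eq_iff[OF p(1)] by auto
    then show ?thesis using that p(3) \<open>y j \<noteq> y i\<close> by (auto simp: transpose_def)
  qed
  ultimately show ?case by (intro bexI[of _ ?p]) auto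
qed

section \<open>Coverings of a base with finitely many sorts\<close>

text \<open>
  What the combinatorial argument uses of a finite cover: \<open>G\<close> is the automorphism group upstairs, and
  the group downstairs consists of the sort-preserving permutations.
\<close>

locale sorted_cover =
  fixes A :: "'a set" and B :: "'b set" and \<pi> :: "'a \<Rightarrow> 'b"
    and G :: "('a \<Rightarrow> 'a) set" and \<kappa> :: "'b \<Rightarrow> 'k"
  assumes countable_base: "countable B"
    and proj_onto: "\<pi> ` A = B"
    and finite_fiber: "b \<in> B \<Longrightarrow> finite (fiber \<pi> A b)"
    and finite_sorts: "finite (\<kappa> ` B)"
    and sort_dichotomy:
      "b \<in> B \<Longrightarrow> {b' \<in> B. \<kappa> b' = \<kappa> b} = {b} \<or> infinite {b' \<in> B. \<kappa> b' = \<kappa> b}"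
    and id_in_G: "id \<in> G"
    and comp_in_G: "g \<in> G \<Longrightarrow> h \<in> G \<Longrightarrow> g \<circ> h \<in> G"
    and inv_in_G: "g \<in> G \<Longrightarrow> inv g \<in> G"
    and G_permutes: "g \<in> G \<Longrightarrow> g permutes A"
    and G_closed: "f permutes A \<Longrightarrow>
      (\<And>F. finite F \<Longrightarrow> F \<subseteq> A \<Longrightarrow> \<exists>g \<in> G. \<forall>a \<in> F. g a = f a) \<Longrightarrow> f \<in> G"
    and descends: "g \<in> G \<Longrightarrow> \<exists>q \<in> sort_perms \<kappa> B. \<forall>a \<in> A. \<pi> (g a) = q (\<pi> a)"
    and lifts: "q \<in> sort_perms \<kappa> B \<Longrightarrow> \<exists>g \<in> G. \<forall>a \<in> A. \<pi> (g a) = q (\<pi> a)"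
begin

definition rigid :: "'b set" where
  "rigid = {b \<in> B. {b' \<in> B. \<kappa> b' = \<kappa> b} = {b}}"

definition stab :: "'b set \<Rightarrow> ('a \<Rightarrow> 'a) set" where
  "stab X = {g \<in> G. \<forall>a \<in> A. \<pi> a \<in> X \<longrightarrow> g a = a}"

lemma proj_in: "a \<in> A \<Longrightarrow> \<pi> a \<in> B"
  using proj_onto by blast

lemma G_in: "g \<in> G \<Longrightarrow> g a \<in> A \<longleftrightarrow> a \<in> A"
  using G_permutes permutes_in_image by fastforce

lemma G_inv [simp]: "g \<in> G \<Longrightarrow> g (inv g a) = a" "g \<in> G \<Longrightarrow> inv g (g a) = a"
  using G_permutes permutes_inverses by metis+

lemma G_proj_iff:
  "g \<in> G \<Longrightarrow> a \<in> A \<Longrightarrow> a' \<in> A \<Longrightarrow> \<pi> (g a) = \<pi> (g a') \<longleftrightarrow> \<pi> a = \<pi> a'"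
  using descends[of g] sort_perms_eq_iff by fastforce

lemma stab_G: "g \<in> stab X \<Longrightarrow> g \<in> G"
  by (simp add: stab_def)

lemma stab_fixes: "g \<in> stab X \<Longrightarrow> a \<in> A \<Longrightarrow> \<pi> a \<in> X \<Longrightarrow> g a = a"
  by (simp add: stab_def)

lemma stab_antimono: "X \<subseteq> Y \<Longrightarrow> stab Y \<subseteq> stab X"
  by (auto simp: stab_def)

lemma id_in_stab: "id \<in> stab X"
  by (simp add: stab_def id_in_G)

lemma comp_in_stab: "g \<in> stab X \<Longrightarrow> h \<in> stab X \<Longrightarrow> g \<circ> h \<in> stab X"
  by (auto simp: stab_def comp_in_G)

lemma inv_in_stab: "g \<in> stab X \<Longrightarrow> inv g \<in> stab X"
  by (auto simp: stab_def inv_in_G) (metis G_inv(2))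

lemma finite_over: "finite X \<Longrightarrow> X \<subseteq> B \<Longrightarrow> finite {a \<in> A. \<pi> a \<in> X}"
proof -
  assume "finite X" "X \<subseteq> B"
  then have "finite (\<Union>b \<in> X. fiber \<pi> A b)" using finite_fiber by blast
  moreover have "{a \<in> A. \<pi> a \<in> X} = (\<Union>b \<in> X. fiber \<pi> A b)" by (auto simp: fiber_def)
  ultimately show ?thesis by simp
qed

lemma finite_rigid: "finite rigid"
proof -
  have "inj_on \<kappa> rigid" by (auto simp: inj_on_def rigid_def)
  moreover have "\<kappa> ` rigid \<subseteq> \<kappa> ` B" by (auto simp: rigid_def)
  ultimately show ?thesis using finite_sorts finite_imageD finite_subset by metis
qed

lemma rigid_fixed: "b \<in> rigid \<Longrightarrow> b' \<in> B \<Longrightarrow> \<kappa> b' = \<kappa> b \<Longrightarrow> b' = b"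
  by (auto simp: rigid_def)

lemma flexible_sort:
  "b \<in> B - rigid \<Longrightarrow> infinite {b' \<in> B. \<kappa> b' = \<kappa> b}"
  using sort_dichotomy by (auto simp: rigid_def)

lemma flexible_iff: "b \<in> B \<Longrightarrow> b' \<in> B \<Longrightarrow> \<kappa> b = \<kappa> b' \<Longrightarrow> b \<in> rigid \<longleftrightarrow> b' \<in> rigid"
  using rigid_fixed by metis

text \<open>
  A supply of infinitely many disjoint sort-preserving copies, all avoiding \<open>Y\<close>, of the part of the
  base on which the sorts are infinite. The copies serve the pigeonhole argument; a single copy
  is an embedding of that part into the complement of \<open>Y\<close>.
\<close>

definition separated_copies :: "'b set \<Rightarrow> (nat \<Rightarrow> 'b \<Rightarrow> 'b) \<Rightarrow> bool" where
  "separated_copies Y r \<longleftrightarrow>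
    (\<forall>j. \<forall>w \<in> B - rigid. r j w \<in> B - rigid - Y \<and> \<kappa> (r j w) = \<kappa> w) \<and>
    (\<forall>w \<in> B - rigid. \<forall>w' \<in> B - rigid. \<forall>j j'. r j w = r j' w' \<longleftrightarrow> j = j' \<and> w = w')"

lemma separated_copiesD:
  assumes "separated_copies Y r"
  shows "w \<in> B - rigid \<Longrightarrow> r j w \<in> B - rigid - Y"
    and "w \<in> B - rigid \<Longrightarrow> \<kappa> (r j w) = \<kappa> w"
    and "w \<in> B - rigid \<Longrightarrow> w' \<in> B - rigid \<Longrightarrow> r j w = r j' w' \<longleftrightarrow> j = j' \<and> w = w'"
  using assms unfolding separated_copies_def by simp_all

lemma separated_copies_exist:
  assumes "finite Y"
  shows "\<exists>r. separated_copies Y r"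
proof -
  have "\<exists>e :: nat \<Rightarrow> 'b. inj e \<and> range e \<subseteq> {b \<in> B. \<kappa> b = k} - Y"
    if "k \<in> \<kappa> ` (B - rigid)" for k
  proof -
    have "infinite ({b \<in> B. \<kappa> b = k} - Y)"
      using that flexible_sort assms by auto
    then show ?thesis by (meson infinite_countable_subset)
  qed
  then obtain e :: "'k \<Rightarrow> nat \<Rightarrow> 'b" where
    "\<forall>k \<in> \<kappa> ` (B - rigid). inj (e k) \<and> range (e k) \<subseteq> {b \<in> B. \<kappa> b = k} - Y"
    using bchoice[of "\<kappa> ` (B - rigid)" "\<lambda>k e. inj e \<and> range e \<subseteq> {b \<in> B. \<kappa> b = k} - Y"] by blast
  then have e: "inj (e (\<kappa> w)) \<and> range (e (\<kappa> w)) \<subseteq> {b \<in> B. \<kappa> b = \<kappa> w} - Y"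
    if "w \<in> B - rigid" for w using that by blast
  \<comment> \<open>Enumerate an infinite part of each sort, and split it among the copies by a pairing function.\<close>
  define r where "r j w = e (\<kappa> w) (prod_encode (j, to_nat_on B w))" for j w
  have r: "r j w \<in> B - Y" "\<kappa> (r j w) = \<kappa> w" if "w \<in> B - rigid" for j w
    using e[OF that] by (auto simp: r_def)
  have "r j w \<in> B - rigid - Y" if "w \<in> B - rigid" for j w
    using r[OF that, of j] flexible_iff[of "r j w" w] that by blast
  moreover have "r j w = r j' w' \<longleftrightarrow> j = j' \<and> w = w'" if w: "w \<in> B - rigid" "w' \<in> B - rigid"
    for j w j' w'
  proof
    assume eq: "r j w = r j' w'"
    then have k: "\<kappa> w = \<kappa> w'" using r(2)[OF w(1), of j] r(2)[OF w(2), of j'] by simp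
    then have "prod_encode (j, to_nat_on B w) = prod_encode (j', to_nat_on B w')"
      using eq injD[OF conjunct1[OF e[OF w(1)]]] unfolding r_def by metis
    then show "j = j' \<and> w = w'" using w countable_base by simp
  qed simp
  ultimately show ?thesis using r(2) unfolding separated_copies_def by (intro exI[of _ r]) simp
qed

text \<open>
  For every \<open>j\<close> some \<open>g j \<in> G\<close> moves \<open>W\<close> to its \<open>j\<close>-th copy and maps every fiber over \<open>Y\<close> to itself.
  Only finitely many maps can be induced over \<open>Y\<close>, so there are \<open>j \<noteq> k\<close> such that \<open>g j\<close> and \<open>g k\<close>
  agree over \<open>Y\<close>, and \<open>u = g k \<circ> inv (g j)\<close> is in the stabiliser and moves the \<open>j\<close>-th copy to the
  \<open>k\<close>-th. As \<open>W\<close> and \<open>f ` W\<close> are disjoint, a permutation fixing \<open>Y\<close> takes the two copies to \<open>W\<close>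
  and \<open>f ` W\<close>; conjugating \<open>u\<close> by a lift of it gives the desired element.
\<close>

lemma stab_moves_to_disjoint:
  assumes Y: "finite Y" "Y \<subseteq> B" and W: "finite W" "W \<subseteq> B - rigid - Y"
    and f: "inj_on f W" "f ` W \<subseteq> B - Y" "\<And>w. w \<in> W \<Longrightarrow> \<kappa> (f w) = \<kappa> w" "f ` W \<inter> W = {}"
  shows "\<exists>g \<in> stab Y. \<forall>a \<in> A. \<pi> a \<in> W \<longrightarrow> \<pi> (g a) = f (\<pi> a)"
proof -
  obtain r where "separated_copies Y r" using separated_copies_exist[OF Y(1)] by blast
  note r = separated_copiesD[OF this]
  have WB: "w \<in> B - rigid" "w \<notin> Y" "f w \<in> B - Y" "f w \<notin> W" if "w \<in> W" for w
    using that W f by auto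
  have "\<exists>g \<in> G. \<forall>a \<in> A. (\<pi> a \<in> Y \<longrightarrow> \<pi> (g a) = \<pi> a) \<and> (\<pi> a \<in> W \<longrightarrow> \<pi> (g a) = r j (\<pi> a))" for j
  proof -
    have "\<exists>p \<in> sort_perms \<kappa> B. (\<forall>b \<in> Y. p b = b) \<and> (\<forall>w \<in> W. p (id w) = r j w)"
    proof (rule sort_perms_extend)
      show "inj_on (r j) W" using WB r(3)[of _ _ j j] by (auto simp: inj_on_def)
      show "r j ` W \<subseteq> B - Y" using r(1)[OF WB(1)] by auto
      show "\<kappa> (id w) = \<kappa> (r j w)" if "w \<in> W" for w using r(2)[OF WB(1)[OF that]] by simp
    qed (use W in auto)
    then obtain p where "p \<in> sort_perms \<kappa> B" "\<forall>y \<in> Y. p y = y" "\<forall>w \<in> W. p w = r j w" by auto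
    then show ?thesis using lifts[of p] by metis
  qed
  then obtain g where g: "\<And>j. g j \<in> G"
    "\<And>j a. a \<in> A \<Longrightarrow> \<pi> a \<in> Y \<Longrightarrow> \<pi> (g j a) = \<pi> a"
    "\<And>j a. a \<in> A \<Longrightarrow> \<pi> a \<in> W \<Longrightarrow> \<pi> (g j a) = r j (\<pi> a)"
    by metis
  let ?S = "{a \<in> A. \<pi> a \<in> Y}"
  have "finite (range (\<lambda>j. restrict (g j) ?S))"
  proof (rule finite_subset)
    show "range (\<lambda>j. restrict (g j) ?S) \<subseteq> ?S \<rightarrow>\<^sub>E ?S"
      using g(1,2) G_in by (auto simp: PiE_def Pi_def)
    show "finite (?S \<rightarrow>\<^sub>E ?S)" using finite_over[OF Y] by (intro finite_PiE) auto
  qed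
  then have "\<not> inj (\<lambda>j. restrict (g j) ?S)" using finite_imageD infinite_UNIV_nat by blast
  then obtain j k where jk: "j \<noteq> k" "restrict (g j) ?S = restrict (g k) ?S"
    unfolding inj_def by blast
  have eq: "g j a = g k a" if "a \<in> A" "\<pi> a \<in> Y" for a
    using that fun_cong[OF jk(2), of a] by simp
  define u where "u = g k \<circ> inv (g j)"
  have u_G: "u \<in> G" using g(1) comp_in_G inv_in_G by (simp add: u_def)
  have u: "u (g j a) = g k a" for a using g(1) by (simp add: u_def)
  have u_fix: "u a = a" if a: "a \<in> A" "\<pi> a \<in> Y" for a
  proof -
    define a' where "a' = inv (g j) a"
    have a': "a' \<in> A" "g j a' = a" using a g(1) inv_in_G G_in by (auto simp: a'_def)
    have "\<pi> (g j a) = \<pi> (g j a')" using a' g(2)[OF a] by simp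
    then have "\<pi> a' \<in> Y" using G_proj_iff[OF g(1)] a' a by metis
    then show ?thesis using u[of a'] eq[of a'] a' by simp
  qed
  let ?x = "case_sum (r j) (r k)" and ?y = "case_sum id f"
  have "\<exists>p \<in> sort_perms \<kappa> B. (\<forall>b \<in> Y. p b = b) \<and> (\<forall>i \<in> W <+> W. p (?x i) = ?y i)"
  proof (rule sort_perms_extend)
    have "inj_on (r i) W" for i using WB r(3)[of _ _ i i] by (auto simp: inj_on_def)
    moreover have "r j w \<noteq> r k w'" if "w \<in> W" "w' \<in> W" for w w'
      using r(3)[OF WB(1)[OF that(1)] WB(1)[OF that(2)], of j k] jk(1) by simp
    ultimately show "inj_on ?x (W <+> W)" by (auto simp: inj_on_def split: sum.splits) metis
    show "inj_on ?y (W <+> W)"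
      using f(1) WB(4) by (auto simp: inj_on_def split: sum.splits)
    show "?x ` (W <+> W) \<subseteq> B - Y" using r(1)[OF WB(1)] by auto
    show "?y ` (W <+> W) \<subseteq> B - Y" using W f(2) by auto
    show "\<kappa> (?x i) = \<kappa> (?y i)" if "i \<in> W <+> W" for i using that r(2)[OF WB(1)] f(3) by auto
  qed (use W in simp)
  then obtain p where p: "p \<in> sort_perms \<kappa> B" "\<forall>y \<in> Y. p y = y"
    and p_sum: "\<forall>i \<in> W <+> W. p (?x i) = ?y i" by blast
  have p_copy: "p (r j w) = w" "p (r k w) = f w" if "w \<in> W" for w
    using p_sum that bspec[OF p_sum, of "Inl w"] bspec[OF p_sum, of "Inr w"] by auto
  obtain v where v: "v \<in> G" "\<And>a. a \<in> A \<Longrightarrow> \<pi> (v a) = p (\<pi> a)" using lifts[OF p(1)] by blast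
  let ?g = "v \<circ> u \<circ> inv v"
  have gG: "?g \<in> G" using v(1) u_G comp_in_G inv_in_G by blast
  have vinv: "inv v a \<in> A" "p (\<pi> (inv v a)) = \<pi> a" if "a \<in> A" for a
    using that v inv_in_G G_in G_inv by metis+
  have "?g a = a" if a: "a \<in> A" "\<pi> a \<in> Y" for a
  proof -
    have "p (\<pi> (inv v a)) = p (\<pi> a)" using vinv[OF a(1)] p(2) a(2) by simp
    then have "\<pi> (inv v a) = \<pi> a" using sort_perms_eq_iff[OF p(1)] by blast
    then show ?thesis using u_fix[of "inv v a"] vinv[OF a(1)] a v(1) by simp
  qed
  then have "?g \<in> stab Y" using gG by (simp add: stab_def)
  moreover have "\<pi> (?g a) = f (\<pi> a)" if a: "a \<in> A" "\<pi> a \<in> W" for a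
  proof -
    have "p (\<pi> (inv v a)) = p (r j (\<pi> a))" using vinv[OF a(1)] p_copy(1) a(2) by simp
    then have 1: "\<pi> (inv v a) = r j (\<pi> a)" using sort_perms_eq_iff[OF p(1)] by blast
    define c where "c = inv (g j) (inv v a)"
    have c: "c \<in> A" "g j c = inv v a" using vinv[OF a(1)] g(1) inv_in_G G_in by (auto simp: c_def)
    have "\<pi> (g j c) = \<pi> (g j a)" using c 1 g(3)[OF a] by simp
    then have "\<pi> c = \<pi> a" using G_proj_iff[OF g(1)] c a by metis
    then have "\<pi> (u (inv v a)) = r k (\<pi> a)" using u[of c] c g(3)[of c k] a by simp
    then show ?thesis using v(2)[of "u (inv v a)"] G_in[OF u_G] vinv[OF a(1)] p_copy(2) a by simp
  qed
  ultimately show ?thesis by blast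
qed

text \<open>A motion between overlapping sets is the composite of two motions through a fresh copy.\<close>

lemma stab_moves:
  assumes Y: "finite Y" "Y \<subseteq> B" and W: "finite W" "W \<subseteq> B - rigid - Y"
    and f: "inj_on f W" "f ` W \<subseteq> B - Y" "\<And>w. w \<in> W \<Longrightarrow> \<kappa> (f w) = \<kappa> w"
  shows "\<exists>g \<in> stab Y. \<forall>a \<in> A. \<pi> a \<in> W \<longrightarrow> \<pi> (g a) = f (\<pi> a)"
proof -
  have "finite (Y \<union> W \<union> f ` W)" using Y W by simp
  from separated_copies_exist[OF this] obtain r where "separated_copies (Y \<union> W \<union> f ` W) r" by blast
  note r = separated_copiesD[OF this]
  let ?r = "r 0"
  have inj_r: "inj_on ?r W" using W r(3)[of _ _ 0 0] by (auto simp: inj_on_def)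
  have rW: "?r ` W \<subseteq> B - rigid - (Y \<union> W \<union> f ` W)"
  proof (rule image_subsetI)
    fix w assume "w \<in> W"
    then show "?r w \<in> B - rigid - (Y \<union> W \<union> f ` W)" using W(2) by (intro r(1)) blast
  qed
  have "\<exists>g \<in> stab Y. \<forall>a \<in> A. \<pi> a \<in> W \<longrightarrow> \<pi> (g a) = ?r (\<pi> a)"
    using W r(2)[of _ 0] rW inj_r by (intro stab_moves_to_disjoint[OF Y W]) auto
  then obtain g where g: "g \<in> stab Y" "\<And>a. a \<in> A \<Longrightarrow> \<pi> a \<in> W \<Longrightarrow> \<pi> (g a) = ?r (\<pi> a)" by blast
  let ?f = "f \<circ> inv_into W ?r"
  have "\<exists>h \<in> stab Y. \<forall>a \<in> A. \<pi> a \<in> ?r ` W \<longrightarrow> \<pi> (h a) = ?f (\<pi> a)"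
  proof (rule stab_moves_to_disjoint[OF Y])
    show "finite (?r ` W)" using W by simp
    show "?r ` W \<subseteq> B - rigid - Y" using rW by blast
    show "inj_on ?f (?r ` W)" using f(1) inj_r by (auto simp: inj_on_def)
    show "?f ` ?r ` W \<subseteq> B - Y" using f(2) inj_r by auto
    show "\<kappa> (?f w) = \<kappa> w" if "w \<in> ?r ` W" for w using that W f(3) inj_r r(2)[of _ 0] by auto
    have "?f ` ?r ` W = f ` W" using inj_r by (simp add: image_image)
    then show "?f ` ?r ` W \<inter> ?r ` W = {}" using rW by blast
  qed
  then obtain h where h: "h \<in> stab Y" "\<And>a. a \<in> A \<Longrightarrow> \<pi> a \<in> ?r ` W \<Longrightarrow> \<pi> (h a) = ?f (\<pi> a)" by blast
  have "\<pi> ((h \<circ> g) a) = f (\<pi> a)" if "a \<in> A" "\<pi> a \<in> W" for a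
    using h(2)[of "g a"] g(2)[of a] that G_in[OF stab_G[OF g(1)]] inj_r by simp
  then show ?thesis using comp_in_stab[OF h(1) g(1)] by blast
qed


section \<open>Shrinking the fiber groups\<close>

text \<open>
  For fixed \<open>c\<close> these finite groups decrease when \<open>X\<close> grows, so they cannot shrink forever.
\<close>

definition local_group :: "'b set \<Rightarrow> 'b \<Rightarrow> ('a \<Rightarrow> 'a) set" where
  "local_group X c = (\<lambda>g. restrict g (fiber \<pi> A c)) ` {g \<in> stab X. \<forall>a \<in> fiber \<pi> A c. \<pi> (g a) = c}"

text \<open>
  Adding finitely many points other than \<open>c\<close> to \<open>Y\<close> does not make the induced group on the fiber
  over \<open>c\<close> any smaller. Stated with elements instead of \<open>local_group\<close>, the condition is easy to
  conjugate.
\<close>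

definition steady :: "'b set \<Rightarrow> 'b \<Rightarrow> bool" where
  "steady Y c \<longleftrightarrow> (\<forall>X. finite X \<longrightarrow> X \<subseteq> B \<longrightarrow> Y \<subseteq> X \<longrightarrow> c \<notin> X \<longrightarrow>
    (\<forall>g \<in> stab Y. (\<forall>a \<in> A. \<pi> a = c \<longrightarrow> \<pi> (g a) = c) \<longrightarrow>
      (\<exists>g' \<in> stab X. \<forall>a \<in> A. \<pi> a = c \<longrightarrow> g' a = g a)))"

lemma steadyD:
  assumes "steady Y c" "finite X" "X \<subseteq> B" "Y \<subseteq> X" "c \<notin> X" "g \<in> stab Y"
    and "\<And>a. a \<in> A \<Longrightarrow> \<pi> a = c \<Longrightarrow> \<pi> (g a) = c"
  shows "\<exists>g' \<in> stab X. \<forall>a \<in> A. \<pi> a = c \<longrightarrow> g' a = g a"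
  using assms unfolding steady_def by simp

lemma steady_mono:
  assumes "steady Y c" "Y \<subseteq> Z"
  shows "steady Z c"
  unfolding steady_def
proof (intro allI impI ballI)
  fix X g assume "finite X" "X \<subseteq> B" "Z \<subseteq> X" "c \<notin> X" "g \<in> stab Z"
    and "\<forall>a \<in> A. \<pi> a = c \<longrightarrow> \<pi> (g a) = c"
  then show "\<exists>g' \<in> stab X. \<forall>a \<in> A. \<pi> a = c \<longrightarrow> g' a = g a"
    using stab_antimono[OF assms(2)] assms(2) by (intro steadyD[OF assms(1)]) auto
qed

lemma finite_local_group:
  assumes "c \<in> B"
  shows "finite (local_group X c)"
proof (rule finite_subset)
  show "local_group X c \<subseteq> fiber \<pi> A c \<rightarrow>\<^sub>E fiber \<pi> A c"
    using G_in stab_G by (auto simp: local_group_def fiber_def PiE_def extensional_def Pi_def)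
  show "finite (fiber \<pi> A c \<rightarrow>\<^sub>E fiber \<pi> A c)"
    using finite_fiber[OF assms] by (intro finite_PiE) auto
qed

text \<open>A finite set with induced group of least possible order is steady.\<close>

lemma steady_exists:
  assumes c: "c \<in> B"
  shows "\<exists>Y. finite Y \<and> Y \<subseteq> B \<and> c \<notin> Y \<and> steady Y c"
proof -
  let ?P = "\<lambda>X. finite X \<and> X \<subseteq> B - {c}"
  have "?P {}" by simp
  from ex_has_least_nat[of ?P, OF this, of "\<lambda>X. card (local_group X c)"]
  obtain Y where Y: "?P Y" and least: "\<And>X. ?P X \<Longrightarrow> card (local_group Y c) \<le> card (local_group X c)" by blast
  have "steady Y c"
    unfolding steady_def
  proof (intro allI impI ballI)
    fix X g assume X: "finite X" "X \<subseteq> B" "Y \<subseteq> X" "c \<notin> X"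
      and g: "g \<in> stab Y" "\<forall>a \<in> A. \<pi> a = c \<longrightarrow> \<pi> (g a) = c"
    have "local_group X c \<subseteq> local_group Y c" using stab_antimono[OF X(3)] unfolding local_group_def by blast
    moreover have "card (local_group Y c) \<le> card (local_group X c)" using X by (intro least) blast
    ultimately have "local_group X c = local_group Y c" using card_seteq[OF finite_local_group[OF c]] by blast
    moreover have "restrict g (fiber \<pi> A c) \<in> local_group Y c" using g by (auto simp: local_group_def fiber_def)
    ultimately have "restrict g (fiber \<pi> A c) \<in> local_group X c" by simp
    then obtain g' where g': "g' \<in> stab X"
      "restrict g (fiber \<pi> A c) = restrict g' (fiber \<pi> A c)" unfolding local_group_def by blast
    have "g' a = g a" if "a \<in> A" "\<pi> a = c" for a
      using fun_cong[OF g'(2), of a] that by (simp add: fiber_def)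
    then show "\<exists>g' \<in> stab X. \<forall>a \<in> A. \<pi> a = c \<longrightarrow> g' a = g a" using g'(1) by blast
  qed
  then show ?thesis using Y by blast
qed

text \<open>
  Steadiness spreads from \<open>c\<close> to the rest of its sort: by \<open>stab_moves\<close> some \<open>h\<close> fixing the points over
  \<open>Y\<close> takes the fiber over \<open>d\<close> to the fiber over \<open>c\<close>, and conjugation by \<open>h\<close> translates the question
  at \<open>d\<close> for \<open>X\<close> into the question at \<open>c\<close> for the image \<open>q ` X\<close>, which still contains \<open>Y\<close>.
\<close>

lemma steady_conjugate:
  assumes Y: "finite Y" "Y \<subseteq> B" "c \<in> B - rigid" "c \<notin> Y" "steady Y c"
    and d: "d \<in> B" "\<kappa> d = \<kappa> c"
  shows "steady Y d"
proof (cases "d \<in> Y")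
  case True
  then show ?thesis by (auto simp: steady_def)
next
  case False
  have "d \<notin> rigid" using flexible_iff[of c d] Y(3) d by simp
  then have "\<exists>h \<in> stab Y. \<forall>a \<in> A. \<pi> a \<in> {d} \<longrightarrow> \<pi> (h a) = c"
    using stab_moves[OF Y(1,2), of "{d}" "\<lambda>_. c"] Y d False by auto
  then obtain h where h: "h \<in> stab Y" "\<And>a. a \<in> A \<Longrightarrow> \<pi> a = d \<Longrightarrow> \<pi> (h a) = c" by auto
  have hG: "h \<in> G" using stab_G[OF h(1)] .
  obtain q where q: "q \<in> sort_perms \<kappa> B" "\<And>a. a \<in> A \<Longrightarrow> \<pi> (h a) = q (\<pi> a)"
    using descends[OF hG] by blast
  have q_d: "q d = c" using d(1) proj_onto h(2) q(2) by fastforce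
  have q_Y: "q y = y" if y: "y \<in> Y" for y
  proof -
    obtain a where "a \<in> A" "\<pi> a = y" using y Y(2) proj_onto by blast
    then show ?thesis using q(2)[of a] stab_fixes[OF h(1), of a] y by simp
  qed
  show ?thesis
    unfolding steady_def
  proof (intro allI impI ballI)
    fix X g assume X: "finite X" "X \<subseteq> B" "Y \<subseteq> X" "d \<notin> X"
      and g: "g \<in> stab Y" "\<forall>a \<in> A. \<pi> a = d \<longrightarrow> \<pi> (g a) = d"
    let ?g = "h \<circ> g \<circ> inv h"
    have gG: "g \<in> G" using stab_G[OF g(1)] .
    have inv_A: "inv h a \<in> A" if "a \<in> A" for a using that G_in[OF inv_in_G[OF hG]] by simp
    have "\<exists>g' \<in> stab (q ` X). \<forall>a \<in> A. \<pi> a = c \<longrightarrow> g' a = ?g a"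
    proof (rule steadyD[OF Y(5)])
      show "finite (q ` X)" using X by simp
      show "q ` X \<subseteq> B" using X(2) sort_perms_in[OF q(1)] by blast
      show "Y \<subseteq> q ` X" using q_Y X(3) by force
      show "c \<notin> q ` X" using q_d X(4) sort_perms_eq_iff[OF q(1)] by (metis imageE)
      show "?g \<in> stab Y" using h(1) g(1) comp_in_stab inv_in_stab by blast
      fix a assume a: "a \<in> A" "\<pi> a = c"
      have "q (\<pi> (inv h a)) = q d" using q(2)[OF inv_A[OF a(1)]] hG a q_d by simp
      then have "\<pi> (inv h a) = d" using sort_perms_eq_iff[OF q(1)] by blast
      then show "\<pi> (?g a) = c" using g(2) inv_A[OF a(1)] h(2) G_in[OF gG] by simp
    qed
    then obtain k where k: "k \<in> stab (q ` X)" "\<And>a. a \<in> A \<Longrightarrow> \<pi> a = c \<Longrightarrow> k a = ?g a" by blast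
    have kG: "k \<in> G" using stab_G[OF k(1)] .
    let ?k = "inv h \<circ> k \<circ> h"
    have "?k a = a" if "a \<in> A" "\<pi> a \<in> X" for a
      using stab_fixes[OF k(1), of "h a"] q(2) that G_in[OF hG] hG by simp
    moreover have "?k \<in> G" by (intro comp_in_G inv_in_G hG kG)
    ultimately have "?k \<in> stab X" by (simp add: stab_def)
    moreover have "?k a = g a" if "a \<in> A" "\<pi> a = d" for a
      using k(2)[of "h a"] h(2) that G_in[OF hG] hG by simp
    ultimately show "\<exists>g' \<in> stab X. \<forall>a \<in> A. \<pi> a = d \<longrightarrow> g' a = g a" by blast
  qed
qed

text \<open>
  Finitely many sorts require only finitely many steady sets, whose union serves all of them. The
  rigid points are included so that all sorts outside \<open>Y\<close> are infinite; at points of \<open>Y\<close> itself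
  steadiness is vacuous.
\<close>

lemma steady_base:
  "\<exists>Y. finite Y \<and> rigid \<subseteq> Y \<and> Y \<subseteq> B \<and> (\<forall>c \<in> B. steady Y c)"
proof -
  have "\<exists>Y. finite Y \<and> Y \<subseteq> B \<and> (\<forall>c \<in> B. \<kappa> c = k \<longrightarrow> steady Y c)" if k: "k \<in> \<kappa> ` (B - rigid)" for k
  proof -
    obtain c where c: "c \<in> B - rigid" "k = \<kappa> c" using k by blast
    from steady_exists[of c] c obtain Y where "finite Y" "Y \<subseteq> B" "c \<notin> Y" "steady Y c" by blast
    then show ?thesis using steady_conjugate[of Y c] c by blast
  qed
  then obtain F where F: "\<forall>k \<in> \<kappa> ` (B - rigid). finite (F k) \<and> F k \<subseteq> B \<and>
      (\<forall>c \<in> B. \<kappa> c = k \<longrightarrow> steady (F k) c)"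
    using bchoice[of "\<kappa> ` (B - rigid)"
        "\<lambda>k Y. finite Y \<and> Y \<subseteq> B \<and> (\<forall>c \<in> B. \<kappa> c = k \<longrightarrow> steady Y c)"] by blast
  let ?Y = "rigid \<union> (\<Union>k \<in> \<kappa> ` (B - rigid). F k)"
  have "\<kappa> ` (B - rigid) \<subseteq> \<kappa> ` B" by blast
  then have "finite (\<kappa> ` (B - rigid))" using finite_sorts finite_subset by blast
  then have "finite ?Y" using F finite_rigid by blast
  moreover have "?Y \<subseteq> B" using F by (auto simp: rigid_def)
  moreover have "steady ?Y c" if "c \<in> B" for c
  proof (cases "c \<in> rigid")
    case True
    then show ?thesis by (auto simp: steady_def)
  next
    case False
    then have "steady (F (\<kappa> c)) c" using F that by blast
    then show ?thesis by (rule steady_mono) (use that False in blast)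
  qed
  ultimately show ?thesis by blast
qed

section \<open>Labels of the points of the cover\<close>

text \<open>
  A labeling that trivialises the cover over the complement of \<open>Y\<close>: it separates the points of each
  fiber there, and every finite sort-preserving partial bijection outside \<open>Y\<close> lifts to a
  label-preserving element that fixes all points over \<open>Y\<close>.
\<close>

definition coordinates_off :: "'b set \<Rightarrow> ('a \<Rightarrow> 'a) \<Rightarrow> bool" where
  "coordinates_off Y l \<longleftrightarrow>
    (\<forall>a \<in> A. \<forall>a' \<in> A. \<pi> a \<notin> Y \<longrightarrow> \<pi> a = \<pi> a' \<longrightarrow> l a = l a' \<longrightarrow> a = a') \<and>
    (\<forall>W f. finite W \<longrightarrow> W \<subseteq> B - Y \<longrightarrow> inj_on f W \<longrightarrow> f ` W \<subseteq> B - Y \<longrightarrow>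
      (\<forall>w \<in> W. \<kappa> (f w) = \<kappa> w) \<longrightarrow>
      (\<exists>g \<in> stab Y. \<forall>a \<in> A. \<pi> a \<in> W \<longrightarrow> \<pi> (g a) = f (\<pi> a) \<and> l (g a) = l a))"

lemma coordinates_offD:
  assumes "coordinates_off Y l"
  shows "a \<in> A \<Longrightarrow> a' \<in> A \<Longrightarrow> \<pi> a \<notin> Y \<Longrightarrow> \<pi> a = \<pi> a' \<Longrightarrow> l a = l a' \<Longrightarrow> a = a'"
    and "finite W \<Longrightarrow> W \<subseteq> B - Y \<Longrightarrow> inj_on f W \<Longrightarrow> f ` W \<subseteq> B - Y \<Longrightarrow>
      (\<And>w. w \<in> W \<Longrightarrow> \<kappa> (f w) = \<kappa> w) \<Longrightarrow>
      \<exists>g \<in> stab Y. \<forall>a \<in> A. \<pi> a \<in> W \<longrightarrow> \<pi> (g a) = f (\<pi> a) \<and> l (g a) = l a"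
  using assms unfolding coordinates_off_def by simp_all

text \<open>
  The label of a point over \<open>c\<close> is its image under a chosen \<open>h c\<close> in the stabiliser of the points
  over \<open>Y\<close> that takes the fiber over \<open>c\<close> to the reference fiber of its sort. Given a lift \<open>g\<close> of
  \<open>f\<close> on \<open>W\<close>, the map \<open>inv (h w) \<circ> h (f w) \<circ> g\<close> returns the fiber over \<open>w\<close> to itself and measures how
  far \<open>g\<close> is from preserving labels there. Steadiness provides \<open>d\<close> with the same effect over \<open>w\<close> that
  fixes the points over the rest of \<open>W\<close>, so \<open>g \<circ> inv d\<close> preserves labels over \<open>w\<close> and does not
  disturb what was achieved over the other points of \<open>W\<close>.
\<close>

lemma coordinates_off_exist:
  assumes Y: "finite Y" "rigid \<subseteq> Y" "Y \<subseteq> B" "\<And>c. c \<in> B \<Longrightarrow> steady Y c"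
  shows "\<exists>l. coordinates_off Y l"
proof -
  have moves: "\<exists>g \<in> stab Y. \<forall>a \<in> A. \<pi> a \<in> W \<longrightarrow> \<pi> (g a) = f (\<pi> a)"
    if "finite W" "W \<subseteq> B - Y" "inj_on f W" "f ` W \<subseteq> B - Y" "\<And>w. w \<in> W \<Longrightarrow> \<kappa> (f w) = \<kappa> w"
    for W and f :: "'b \<Rightarrow> 'b"
    using that Y(2) by (intro stab_moves[OF Y(1,3)]) auto
  \<comment> \<open>The reference fiber of sort \<open>k\<close> lies over \<open>\<beta> k\<close>.\<close>
  define \<beta> where "\<beta> k = (SOME b. b \<in> B - Y \<and> \<kappa> b = k)" for k
  have \<beta>: "\<beta> (\<kappa> c) \<in> B - Y" "\<kappa> (\<beta> (\<kappa> c)) = \<kappa> c" if "c \<in> B - Y" for c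
    using someI[of "\<lambda>b. b \<in> B - Y \<and> \<kappa> b = \<kappa> c" c] that by (auto simp: \<beta>_def)
  have "\<exists>h \<in> stab Y. \<forall>a \<in> A. \<pi> a = c \<longrightarrow> \<pi> (h a) = \<beta> (\<kappa> c)" if "c \<in> B - Y" for c
    using moves[of "{c}" "\<lambda>_. \<beta> (\<kappa> c)"] \<beta>[OF that] that by auto
  then obtain h where h: "\<And>c. c \<in> B - Y \<Longrightarrow> h c \<in> stab Y"
    "\<And>c a. c \<in> B - Y \<Longrightarrow> a \<in> A \<Longrightarrow> \<pi> a = c \<Longrightarrow> \<pi> (h c a) = \<beta> (\<kappa> c)" by metis
  have hG: "h c \<in> G" if "c \<in> B - Y" for c using stab_G[OF h(1)[OF that]] .
  define l where "l a = h (\<pi> a) a" for a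
  have l_inj: "a = a'" if "a \<in> A" "a' \<in> A" "\<pi> a \<notin> Y" "\<pi> a = \<pi> a'" "l a = l a'" for a a'
  proof -
    have "\<pi> a \<in> B - Y" using that proj_in by blast
    from G_inv(2)[OF hG[OF this]] show ?thesis using that(4,5) unfolding l_def by metis
  qed
  have "\<exists>g \<in> stab Y. \<forall>a \<in> A. \<pi> a \<in> W \<longrightarrow> \<pi> (g a) = f (\<pi> a) \<and> l (g a) = l a"
    if W: "finite W" "W \<subseteq> B - Y"
      and f: "inj_on f W" "f ` W \<subseteq> B - Y" "\<And>w. w \<in> W \<Longrightarrow> \<kappa> (f w) = \<kappa> w" for W f
  proof -
    have "\<exists>g \<in> stab Y. (\<forall>a \<in> A. \<pi> a \<in> W \<longrightarrow> \<pi> (g a) = f (\<pi> a)) \<and>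
        (\<forall>a \<in> A. \<pi> a \<in> V \<longrightarrow> l (g a) = l a)" if "V \<subseteq> W" for V
      using finite_subset[OF that W(1)] that
    proof (induction V rule: finite_induct)
      case empty
      show ?case using moves[OF W f] by simp
    next
      case (insert w V)
      then obtain g where g: "g \<in> stab Y" "\<And>a. a \<in> A \<Longrightarrow> \<pi> a \<in> W \<Longrightarrow> \<pi> (g a) = f (\<pi> a)"
        "\<And>a. a \<in> A \<Longrightarrow> \<pi> a \<in> V \<Longrightarrow> l (g a) = l a" by auto
      have w: "w \<in> W" "w \<in> B - Y" "f w \<in> B - Y" "\<kappa> (f w) = \<kappa> w"
        using insert.prems W f by auto
      have gG: "g \<in> G" using stab_G[OF g(1)] .
      have hw: "h w \<in> G" "h (f w) \<in> G" using hG w by auto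
      let ?d = "inv (h w) \<circ> h (f w) \<circ> g"
      \<comment> \<open>\<open>W\<close> in place of \<open>V\<close>: the projection of \<open>g\<close> must survive on all of \<open>W\<close>.\<close>
      let ?X = "Y \<union> (W - {w})"
      have dY: "?d \<in> stab Y"
        using h(1)[OF w(2)] h(1)[OF w(3)] g(1) by (intro comp_in_stab inv_in_stab)
      have d_fib: "\<pi> (?d a) = w" if a: "a \<in> A" "\<pi> a = w" for a
      proof -
        have ga: "g a \<in> A" "\<pi> (g a) = f w" using a g(2) w(1) G_in[OF gG] by auto
        have 1: "h (f w) (g a) \<in> A" "\<pi> (h (f w) (g a)) = \<beta> (\<kappa> w)"
          using ga h(2)[OF w(3)] G_in[OF hw(2)] w(4) by auto
        have "?d a \<in> A" using 1 G_in[OF inv_in_G[OF hw(1)]] by simp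
        moreover have "\<pi> (h w (?d a)) = \<pi> (h w a)" using 1 h(2)[OF w(2) a] hw(1) by simp
        ultimately show ?thesis using G_proj_iff[OF hw(1)] a by metis
      qed
      have "\<exists>d' \<in> stab ?X. \<forall>a \<in> A. \<pi> a = w \<longrightarrow> d' a = ?d a"
        using W Y w by (intro steadyD[OF Y(4) _ _ _ _ dY] d_fib) auto
      then obtain d where d: "d \<in> stab ?X" "\<And>a. a \<in> A \<Longrightarrow> \<pi> a = w \<Longrightarrow> d a = ?d a" by blast
      have dG: "d \<in> G" using stab_G[OF d(1)] .
      have inv_d: "inv d \<in> stab ?X" using inv_in_stab[OF d(1)] .
      let ?g = "g \<circ> inv d"
      have "?g \<in> stab Y" using g(1) inv_d stab_antimono[of Y ?X] comp_in_stab by blast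
      moreover have off_w: "?g a = g a" if "a \<in> A" "\<pi> a \<in> W" "\<pi> a \<noteq> w" for a
        using stab_fixes[OF inv_d, of a] that by simp
      have at_w: "\<pi> (?g a) = f w \<and> l (?g a) = l a" if a: "a \<in> A" "\<pi> a = w" for a
      proof -
        define a' where "a' = inv d a"
        have a': "a' \<in> A" "d a' = a" using a dG G_in[OF inv_in_G[OF dG]] by (auto simp: a'_def)
        define e where "e = inv ?d a"
        have dG': "?d \<in> G" using stab_G[OF dY] .
        have e: "e \<in> A" "?d e = a" using a G_in[OF inv_in_G[OF dG']] G_inv(1)[OF dG', of a]
          by (auto simp: e_def)
        have "\<pi> (?d e) = \<pi> (?d a)" using d_fib[OF a] a e by simp
        then have "\<pi> e = w" using G_proj_iff[OF dG' e(1) a(1)] a(2) by simp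
        then have "d e = d a'" using d(2) e a' by simp
        then have "e = a'" using G_inv(2)[OF dG] by metis
        then have 1: "?d a' = a" "\<pi> a' = w" using e \<open>\<pi> e = w\<close> by auto
        have ga: "\<pi> (g a') = f w" using g(2)[OF a'(1)] 1 w by simp
        have "l (g a') = h w (?d a')" using ga hw(1) by (simp add: l_def)
        also have "\<dots> = l a" using 1 a by (simp add: l_def)
        finally show ?thesis using ga by (simp add: a'_def)
      qed
      have "\<pi> (?g a) = f (\<pi> a)" if "a \<in> A" "\<pi> a \<in> W" for a
        using that off_w[OF that] at_w[OF that(1)] g(2)[OF that] by (cases "\<pi> a = w") simp_all
      moreover have "l (?g a) = l a" if "a \<in> A" "\<pi> a \<in> insert w V" for a
        using that off_w[OF that(1)] at_w[OF that(1)] g(3)[OF that(1)] insert.prems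
        by (cases "\<pi> a = w") auto
      ultimately show ?case by blast
    qed
    from this[of W] show ?thesis by blast
  qed
  moreover have "\<forall>a \<in> A. \<forall>a' \<in> A. \<pi> a \<notin> Y \<longrightarrow> \<pi> a = \<pi> a' \<longrightarrow> l a = l a' \<longrightarrow> a = a'"
    using l_inj by blast
  ultimately have "coordinates_off Y l" unfolding coordinates_off_def by simp
  then show ?thesis by blast
qed

text \<open>
  The set \<open>W n\<close> holds the first \<open>n\<close> points of an enumeration of the base. The \<open>n\<close>-th approximation
  \<open>g\<close> already moves \<open>W n\<close> as \<open>\<phi>\<close> does; the next one is \<open>k \<circ> g\<close>, where \<open>k\<close> fixes the points over
  \<open>\<phi> ` W n\<close> and moves the image of the new point to where \<open>\<phi>\<close> wants it. Thus the approximations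
  do not change any more over \<open>W n\<close>. In general \<open>\<phi>\<close> is not surjective and the limit is not in
  \<open>G\<close>.
\<close>

lemma approximate_embedding:
  assumes \<phi>: "inj_on \<phi> B" "\<phi> ` B \<subseteq> B" "\<And>b. b \<in> B \<Longrightarrow> \<kappa> (\<phi> b) = \<kappa> b"
  defines "W \<equiv> \<lambda>n. {b \<in> B. to_nat_on B b < n}"
  shows "\<exists>g :: nat \<Rightarrow> 'a \<Rightarrow> 'a. (\<forall>n. g n \<in> stab rigid \<and>
    (\<forall>a \<in> A. \<pi> a \<in> W n \<longrightarrow> \<pi> (g n a) = \<phi> (\<pi> a) \<and> (\<forall>m \<ge> n. g m a = g n a)))"
proof -
  have fin_W: "finite (W n)" for n
    using finite_imageD[of "to_nat_on B" "W n"] inj_on_subset[OF inj_on_to_nat_on[OF countable_base], of "W n"]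
      finite_subset[of "to_nat_on B ` W n" "{..<n}"] by (auto simp: W_def)
  have rigid_B: "rigid \<subseteq> B" by (auto simp: rigid_def)
  have \<phi>_rigid: "\<phi> b = b" if "b \<in> rigid" for b using that \<phi> rigid_B rigid_fixed by blast
  have \<phi>_flex: "\<phi> b \<in> B - rigid" if "b \<in> B - rigid" for b
    using that \<phi> flexible_iff[of b "\<phi> b"] by auto
  have "\<exists>g. \<forall>n. (g n \<in> stab rigid \<and> (\<forall>a \<in> A. \<pi> a \<in> W n \<longrightarrow> \<pi> (g n a) = \<phi> (\<pi> a))) \<and>
    (\<forall>a \<in> A. \<pi> a \<in> W n \<longrightarrow> g (Suc n) a = g n a)"
  proof (rule dependent_nat_choice)
    show "\<exists>g. g \<in> stab rigid \<and> (\<forall>a \<in> A. \<pi> a \<in> W 0 \<longrightarrow> \<pi> (g a) = \<phi> (\<pi> a))"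
      using id_in_stab by (auto simp: W_def)
  next
    fix g n assume g: "g \<in> stab rigid \<and> (\<forall>a \<in> A. \<pi> a \<in> W n \<longrightarrow> \<pi> (g a) = \<phi> (\<pi> a))"
    then have gG: "g \<in> G" using stab_G by blast
    obtain q where q: "q \<in> sort_perms \<kappa> B" "\<And>a. a \<in> A \<Longrightarrow> \<pi> (g a) = q (\<pi> a)"
      using descends[OF gG] by blast
    have q_inv: "inv q (q b) = b" for b
      using q(1) permutes_inverses(2) by (fastforce simp: sort_perms_def)
    have q_W: "q w = \<phi> w" if w: "w \<in> W n" for w
    proof -
      have "w \<in> B" using that by (simp add: W_def)
      then obtain a where "a \<in> A" "\<pi> a = w" using proj_onto by blast
      then show ?thesis using q(2)[of a] g w by simp
    qed
    let ?V = "W (Suc n) - W n - rigid" and ?Y = "rigid \<union> \<phi> ` W n" and ?f = "\<phi> \<circ> inv q"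
    have V: "v \<in> B - rigid" "v \<notin> W n" if "v \<in> ?V" for v using that by (auto simp: W_def)
    have "\<exists>k \<in> stab ?Y. \<forall>a \<in> A. \<pi> a \<in> q ` ?V \<longrightarrow> \<pi> (k a) = ?f (\<pi> a)"
    proof (rule stab_moves)
      show "finite ?Y" using fin_W finite_rigid by simp
      show "?Y \<subseteq> B" using rigid_B \<phi>(2) by (auto simp: W_def)
      show "finite (q ` ?V)" using fin_W by simp
      show "q ` ?V \<subseteq> B - rigid - ?Y"
      proof (rule image_subsetI)
        fix v assume v: "v \<in> ?V"
        have "q v \<in> B - rigid"
          using V[OF v] sort_perms_in[OF q(1)] sort_perms_sort[OF q(1)] flexible_iff[of v "q v"] by auto
        moreover have "q v \<notin> \<phi> ` W n" using V[OF v] q_W sort_perms_eq_iff[OF q(1)] by (metis imageE)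
        ultimately show "q v \<in> B - rigid - ?Y" by blast
      qed
      show "inj_on ?f (q ` ?V)"
        using inj_on_subset[OF \<phi>(1), of ?V] by (auto simp: inj_on_def q_inv W_def)
      show "?f ` q ` ?V \<subseteq> B - ?Y"
      proof -
        have "\<phi> v \<in> B - ?Y" if "v \<in> ?V" for v
        proof -
          have "\<phi> v \<notin> \<phi> ` W n"
            using V[OF that] inj_on_image_mem_iff[OF \<phi>(1), of v "W n"] by (auto simp: W_def)
          then show ?thesis using \<phi>_flex[OF V(1)[OF that]] by blast
        qed
        then show ?thesis unfolding image_image o_apply q_inv by (rule image_subsetI)
      qed
      show "\<kappa> (?f w) = \<kappa> w" if "w \<in> q ` ?V" for w
        using that V \<phi>(3) sort_perms_sort[OF q(1)] by (auto simp: q_inv W_def)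
    qed
    then obtain k where k: "k \<in> stab ?Y" "\<And>a. a \<in> A \<Longrightarrow> \<pi> a \<in> q ` ?V \<Longrightarrow> \<pi> (k a) = ?f (\<pi> a)"
      by blast
    have old: "(k \<circ> g) a = g a" if "a \<in> A" "\<pi> a \<in> W n" for a
      using stab_fixes[OF k(1), of "g a"] g that G_in[OF gG] by simp
    have kr: "k \<circ> g \<in> stab rigid" using k(1) g stab_antimono[of rigid ?Y] comp_in_stab by blast
    have "\<pi> ((k \<circ> g) a) = \<phi> (\<pi> a)" if a: "a \<in> A" "\<pi> a \<in> W (Suc n)" for a
    proof -
      consider "\<pi> a \<in> W n" | "\<pi> a \<in> rigid" | "\<pi> a \<in> ?V" using a by blast
      then show ?thesis
      proof cases
        case 1
        then show ?thesis using old[OF a(1)] g a(1) by simp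
      next
        case 2
        then show ?thesis using stab_fixes[OF kr a(1)] \<phi>_rigid by simp
      next
        case 3
        then show ?thesis using k(2)[of "g a"] q(2)[OF a(1)] G_in[OF gG] a(1) q_inv by simp
      qed
    qed
    then show "\<exists>g'. (g' \<in> stab rigid \<and> (\<forall>a \<in> A. \<pi> a \<in> W (Suc n) \<longrightarrow> \<pi> (g' a) = \<phi> (\<pi> a))) \<and>
        (\<forall>a \<in> A. \<pi> a \<in> W n \<longrightarrow> g' a = g a)"
      using kr old by blast
  qed
  then obtain g where g: "\<And>n. g n \<in> stab rigid"
    "\<And>n a. a \<in> A \<Longrightarrow> \<pi> a \<in> W n \<Longrightarrow> \<pi> (g n a) = \<phi> (\<pi> a)"
    "\<And>n a. a \<in> A \<Longrightarrow> \<pi> a \<in> W n \<Longrightarrow> g (Suc n) a = g n a" by blast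
  have "g m a = g n a" if a: "a \<in> A" "\<pi> a \<in> W n" and "n \<le> m" for m n a
    using that(3)
  proof (induction m rule: dec_induct)
    case (step m)
    then have "\<pi> a \<in> W m" using a(2) by (auto simp: W_def)
    then show ?case using g(3)[OF a(1)] step by simp
  qed simp
  then show ?thesis using g(1,2) by (intro exI[of _ g]) blast
qed

text \<open>
  Let \<open>\<phi>\<close> embed the base into itself so that only rigid points are mapped into \<open>Y\<close>, and let \<open>g n\<close>
  approximate \<open>\<phi>\<close>. A point over a non-rigid \<open>b\<close> is labeled by the label of its eventual image under
  the \<open>g n\<close>, which lies over \<open>\<phi> b\<close>, outside \<open>Y\<close>. If \<open>k\<close> is a label-preserving lift of the partial
  map \<open>\<phi> v \<mapsto> \<phi> (q v)\<close>, then \<open>inv (g n) \<circ> k \<circ> g n\<close> is one of \<open>q\<close>, for \<open>n\<close> large enough. Over a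
  rigid point nothing may move, and each point can be its own label.
\<close>

lemma finite_labels:
  "\<exists>l :: 'a \<Rightarrow> 'a. (\<forall>a \<in> A. \<forall>a' \<in> A. \<pi> a = \<pi> a' \<longrightarrow> l a = l a' \<longrightarrow> a = a') \<and>
    (\<forall>q \<in> sort_perms \<kappa> B. \<forall>X. finite X \<longrightarrow> X \<subseteq> B \<longrightarrow>
      (\<exists>g \<in> G. \<forall>a \<in> A. \<pi> a \<in> X \<longrightarrow> \<pi> (g a) = q (\<pi> a) \<and> l (g a) = l a))"
proof -
  obtain Y where Y: "finite Y" "rigid \<subseteq> Y" "Y \<subseteq> B" "\<And>c. c \<in> B \<Longrightarrow> steady Y c"
    using steady_base by blast
  obtain l0 where "coordinates_off Y l0" using coordinates_off_exist[OF Y] by blast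
  note l0_inj = coordinates_offD(1)[OF this] and l0 = coordinates_offD(2)[OF this]
  obtain r where "separated_copies Y r" using separated_copies_exist[OF Y(1)] by blast
  note r = separated_copiesD[OF this]
  define \<phi> where "\<phi> b = (if b \<in> rigid then b else r 0 b)" for b
  have \<phi>: "\<phi> b \<in> B - rigid - Y" "\<kappa> (\<phi> b) = \<kappa> b" if "b \<in> B - rigid" for b
    using r(1,2)[OF that, of 0] that by (auto simp: \<phi>_def)
  have \<phi>_rigid: "\<phi> b = b" if "b \<in> rigid" for b using that by (simp add: \<phi>_def)
  have rigid_B: "rigid \<subseteq> B" by (auto simp: rigid_def)
  have \<phi>_B: "\<phi> ` B \<subseteq> B" using \<phi>(1) \<phi>_rigid by (metis DiffD1 DiffI image_subsetI)
  have \<phi>_sort: "\<kappa> (\<phi> b) = \<kappa> b" if "b \<in> B" for b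
    using that \<phi>(2) \<phi>_rigid by (cases "b \<in> rigid") auto
  have \<phi>_inj: "inj_on \<phi> B"
  proof (rule inj_onI)
    fix b b' assume b: "b \<in> B" "b' \<in> B" "\<phi> b = \<phi> b'"
    then have "\<kappa> b = \<kappa> b'" using \<phi>_sort by metis
    then have "b \<in> rigid \<longleftrightarrow> b' \<in> rigid" using flexible_iff b by blast
    then show "b = b'" using b r(3)[of b b' 0 0] by (auto simp: \<phi>_def split: if_splits)
  qed
  define W where "W n = {b \<in> B. to_nat_on B b < n}" for n
  obtain g where g: "\<And>n. g n \<in> stab rigid"
    "\<And>n a. a \<in> A \<Longrightarrow> \<pi> a \<in> W n \<Longrightarrow> \<pi> (g n a) = \<phi> (\<pi> a)"
    "\<And>n m a. a \<in> A \<Longrightarrow> \<pi> a \<in> W n \<Longrightarrow> n \<le> m \<Longrightarrow> g m a = g n a"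
    using approximate_embedding[OF \<phi>_inj \<phi>_B \<phi>_sort, folded W_def] by blast
  have gG: "g n \<in> G" for n using stab_G[OF g(1)] .
  define l where "l a = (if \<pi> a \<in> rigid then a else l0 (g (Suc (to_nat_on B (\<pi> a))) a))" for a
  have l_eq: "l a = l0 (g n a)" if "a \<in> A" "\<pi> a \<in> W n" "\<pi> a \<notin> rigid" for a n
  proof -
    have "\<pi> a \<in> W (Suc (to_nat_on B (\<pi> a)))" "Suc (to_nat_on B (\<pi> a)) \<le> n"
      using that by (auto simp: W_def)
    then show ?thesis using g(3)[OF that(1)] that(3) by (metis l_def)
  qed
  have in_W: "\<exists>n. X \<subseteq> W n" if X: "finite X" "X \<subseteq> B" for X
  proof -
    obtain n where "\<forall>i \<in> to_nat_on B ` X. i < n" using X(1) finite_nat_set_iff_bounded by blast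
    then show ?thesis using X(2) by (intro exI[of _ n]) (auto simp: W_def)
  qed
  have "a = a'" if a: "a \<in> A" "a' \<in> A" "\<pi> a = \<pi> a'" "l a = l a'" for a a'
  proof (cases "\<pi> a \<in> rigid")
    case True
    then show ?thesis using a by (simp add: l_def)
  next
    case False
    obtain n where n: "\<pi> a \<in> W n" using in_W[of "{\<pi> a}"] proj_in[OF a(1)] by auto
    have "l0 (g n a) = l0 (g n a')" using l_eq[of a n] l_eq[of a' n] a n False by simp
    moreover have "\<pi> (g n a) = \<phi> (\<pi> a)" "\<pi> (g n a') = \<phi> (\<pi> a)"
      using g(2)[OF a(1) n] g(2)[OF a(2), of n] n a(3) by auto
    moreover have "\<phi> (\<pi> a) \<notin> Y" using \<phi>(1)[of "\<pi> a"] False proj_in[OF a(1)] by blast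
    ultimately have "g n a = g n a'" using l0_inj G_in[OF gG] a by metis
    then show ?thesis using G_inv(2)[OF gG] by metis
  qed
  moreover have "\<exists>g \<in> G. \<forall>a \<in> A. \<pi> a \<in> X \<longrightarrow> \<pi> (g a) = q (\<pi> a) \<and> l (g a) = l a"
    if q: "q \<in> sort_perms \<kappa> B" and X: "finite X" "X \<subseteq> B" for q X
  proof -
    have "finite (X \<union> q ` X)" "X \<union> q ` X \<subseteq> B" using X sort_perms_in[OF q] by auto
    then obtain n where n: "X \<subseteq> W n" "q ` X \<subseteq> W n" using in_W by (metis Un_subset_iff)
    let ?V = "X - rigid" and ?f = "\<phi> \<circ> q \<circ> inv_into B \<phi>"
    have V: "v \<in> B - rigid" "q v \<in> B - rigid" if "v \<in> ?V" for v
      using that X sort_perms_in[OF q] sort_perms_sort[OF q] flexible_iff[of v "q v"] by auto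
    have inv_\<phi>: "inv_into B \<phi> (\<phi> v) = v" if "v \<in> B" for v using \<phi>_inj that by simp
    have "\<exists>k \<in> stab Y. \<forall>a \<in> A. \<pi> a \<in> \<phi> ` ?V \<longrightarrow> \<pi> (k a) = ?f (\<pi> a) \<and> l0 (k a) = l0 a"
    proof (rule l0)
      show "finite (\<phi> ` ?V)" using X by simp
      show "\<phi> ` ?V \<subseteq> B - Y" using \<phi>(1)[OF V(1)] by auto
      show "inj_on ?f (\<phi> ` ?V)"
      proof (rule inj_onI)
        fix x y assume "x \<in> \<phi> ` ?V" "y \<in> \<phi> ` ?V" and eq: "?f x = ?f y"
        then obtain v w where vw: "v \<in> ?V" "w \<in> ?V" "x = \<phi> v" "y = \<phi> w" by blast
        then have "\<phi> (q v) = \<phi> (q w)" using eq inv_\<phi> V(1) by simp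
        then have "q v = q w" using inj_onD[OF \<phi>_inj] V(2) vw by blast
        then show "x = y" using sort_perms_eq_iff[OF q] vw by simp
      qed
      show "?f ` \<phi> ` ?V \<subseteq> B - Y" using \<phi>(1)[OF V(2)] inv_\<phi> X(2) by auto
      show "\<kappa> (?f w) = \<kappa> w" if w: "w \<in> \<phi> ` ?V" for w
      proof -
        obtain v where v: "v \<in> ?V" "w = \<phi> v" using w by blast
        then show ?thesis using inv_\<phi>[of v] V[OF v(1)] \<phi>(2) sort_perms_sort[OF q] by simp
      qed
    qed
    then obtain k where k: "k \<in> stab Y"
      "\<And>a. a \<in> A \<Longrightarrow> \<pi> a \<in> \<phi> ` ?V \<Longrightarrow> \<pi> (k a) = ?f (\<pi> a) \<and> l0 (k a) = l0 a" by blast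
    have kG: "k \<in> G" using stab_G[OF k(1)] .
    let ?g = "inv (g n) \<circ> k \<circ> g n"
    have g'G: "?g \<in> G" using gG kG comp_in_G inv_in_G by blast
    have "\<pi> (?g a) = q (\<pi> a) \<and> l (?g a) = l a" if a: "a \<in> A" "\<pi> a \<in> X" for a
    proof (cases "\<pi> a \<in> rigid")
      case True
      have "g n a = a" using stab_fixes[OF g(1) a(1) True] .
      moreover have "k a = a" using stab_fixes[OF k(1) a(1)] True Y(2) by blast
      ultimately have "?g a = a" using G_inv(2)[OF gG, of n a] by simp
      moreover have "q (\<pi> a) = \<pi> a"
        using rigid_fixed[OF True] sort_perms_in[OF q] sort_perms_sort[OF q] proj_in[OF a(1)] by blast
      ultimately show ?thesis by simp
    next
      case False
      then have v: "\<pi> a \<in> ?V" using a by blast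
      have ga: "g n a \<in> A" "\<pi> (g n a) = \<phi> (\<pi> a)" using G_in[OF gG] a g(2) n by auto
      have kga: "\<pi> (k (g n a)) = \<phi> (q (\<pi> a))" "l0 (k (g n a)) = l0 (g n a)"
        using k(2)[OF ga(1)] ga(2) v inv_\<phi> proj_in[OF a(1)] by auto
      have g'A: "?g a \<in> A" using G_in[OF g'G] a by blast
      have gg: "g n (?g a) = k (g n a)" using G_inv(1)[OF gG] by simp
      have "q (\<pi> a) \<in> \<pi> ` A" using V(2)[OF v] proj_onto by simp
      then obtain e where e: "e \<in> A" "\<pi> e = q (\<pi> a)" by (metis imageE)
      have "q (\<pi> a) \<in> W n" using subsetD[OF n(2) imageI[OF a(2)]] .
      then have "\<pi> (g n (?g a)) = \<pi> (g n e)" using gg kga(1) g(2)[OF e(1), of n] e by simp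
      then have 1: "\<pi> (?g a) = q (\<pi> a)" using G_proj_iff[OF gG g'A e(1)] e by simp
      have "l (?g a) = l0 (g n (?g a))"
        using l_eq[OF g'A] 1 \<open>q (\<pi> a) \<in> W n\<close> V(2)[OF v] by (metis DiffD2)
      also have "\<dots> = l a" using gg kga(2) l_eq[of a n] n a False by auto
      finally show ?thesis using 1 by simp
    qed
    then show ?thesis using g'G by blast
  qed
  ultimately show ?thesis by (intro exI[of _ l]) blast
qed

text \<open>
  A label-preserving lift of \<open>q\<close> is determined pointwise, since \<open>a\<close> must go to the point over
  \<open>q (\<pi> a)\<close> with the label of \<open>a\<close>. Hence the lifts on finite pieces agree with one map, which
  belongs to \<open>G\<close> because \<open>G\<close> is closed.
\<close>

lemma labels_exist:
  "\<exists>l :: 'a \<Rightarrow> 'a. (\<forall>a \<in> A. \<forall>a' \<in> A. \<pi> a = \<pi> a' \<longrightarrow> l a = l a' \<longrightarrow> a = a') \<and>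
    (\<forall>q \<in> sort_perms \<kappa> B. \<exists>g \<in> G. \<forall>a \<in> A. \<pi> (g a) = q (\<pi> a) \<and> l (g a) = l a)"
proof -
  obtain l :: "'a \<Rightarrow> 'a" where l: "\<And>a a'. a \<in> A \<Longrightarrow> a' \<in> A \<Longrightarrow> \<pi> a = \<pi> a' \<Longrightarrow> l a = l a' \<Longrightarrow> a = a'"
    and fin: "\<And>q X. q \<in> sort_perms \<kappa> B \<Longrightarrow> finite X \<Longrightarrow> X \<subseteq> B \<Longrightarrow>
      \<exists>g \<in> G. \<forall>a \<in> A. \<pi> a \<in> X \<longrightarrow> \<pi> (g a) = q (\<pi> a) \<and> l (g a) = l a"
    using finite_labels by metis
  have "\<exists>g \<in> G. \<forall>a \<in> A. \<pi> (g a) = q (\<pi> a) \<and> l (g a) = l a" if q: "q \<in> sort_perms \<kappa> B" for q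
  proof -
    have pt: "\<exists>a' \<in> A. \<pi> a' = p (\<pi> a) \<and> l a' = l a" if "p \<in> sort_perms \<kappa> B" "a \<in> A" for p a
      using fin[OF that(1), of "{\<pi> a}"] that(2) proj_in G_in by auto
    obtain f where f: "\<And>a. a \<in> A \<Longrightarrow> f a \<in> A \<and> \<pi> (f a) = q (\<pi> a) \<and> l (f a) = l a"
      using pt[OF q] by metis
    define g where "g a = (if a \<in> A then f a else a)" for a
    have g: "g a \<in> A" "\<pi> (g a) = q (\<pi> a)" "l (g a) = l a" if "a \<in> A" for a
      using f[OF that] that by (auto simp: g_def)
    have "g permutes A"
    proof (rule bij_imp_permutes)
      have "inj_on g A" by (rule inj_onI) (metis g l sort_perms_eq_iff[OF q])
      moreover have "A \<subseteq> g ` A"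
      proof
        fix a assume a: "a \<in> A"
        obtain a' where a': "a' \<in> A" "\<pi> a' = inv q (\<pi> a)" "l a' = l a"
          using pt[OF inv_in_sort_perms[OF q] a] by blast
        have "q (inv q (\<pi> a)) = \<pi> a"
          using q permutes_inverses(1) by (fastforce simp: sort_perms_def)
        then have "g a' = a" using g[OF a'(1)] a' a l by simp
        then show "a \<in> g ` A" using a'(1) by blast
      qed
      ultimately show "bij_betw g A A" using g(1) by (auto simp: bij_betw_def)
    qed (simp add: g_def)
    then have "g \<in> G"
    proof (rule G_closed)
      fix F assume F: "finite F" "F \<subseteq> A"
      have "finite (\<pi> ` F)" "\<pi> ` F \<subseteq> B" using F proj_in by auto
      from fin[OF q this] obtain k where k: "k \<in> G"
        "\<And>a. a \<in> A \<Longrightarrow> \<pi> a \<in> \<pi> ` F \<Longrightarrow> \<pi> (k a) = q (\<pi> a) \<and> l (k a) = l a" by blast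
      have "k a = g a" if "a \<in> F" for a
        using l[of "k a" "g a"] k(2)[of a] g[of a] G_in[OF k(1)] F(2) that by auto
      then show "\<exists>k \<in> G. \<forall>a \<in> F. k a = g a" using k(1) by blast
    qed
    then show ?thesis using g by blast
  qed
  then show ?thesis using l by (intro exI[of _ l]) blast
qed

end

section \<open>Automorphism groups and first-order reducts\<close>

lemma AutI:
  assumes "g permutes universe \<AA>"
    and "\<And>s xs. s \<in> symbols \<AA> \<Longrightarrow> xs \<in> tuples (universe \<AA>) (arity \<AA> s) \<Longrightarrow>
      map g xs \<in> interp \<AA> s \<longleftrightarrow> xs \<in> interp \<AA> s"
  shows "g \<in> Aut \<AA>"
  using assms by (simp add: Aut_def)

lemma Aut_permutes: "g \<in> Aut \<AA> \<Longrightarrow> g permutes universe \<AA>"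
  by (simp add: Aut_def)

lemma Aut_interp:
  "g \<in> Aut \<AA> \<Longrightarrow> s \<in> symbols \<AA> \<Longrightarrow> xs \<in> tuples (universe \<AA>) (arity \<AA> s) \<Longrightarrow>
    map g xs \<in> interp \<AA> s \<longleftrightarrow> xs \<in> interp \<AA> s"
  by (simp add: Aut_def)

lemma map_in_tuples_iff: "g permutes U \<Longrightarrow> map g xs \<in> tuples U n \<longleftrightarrow> xs \<in> tuples U n"
  by (auto simp: tuples_def permutes_in_image)

lemma id_in_Aut: "id \<in> Aut \<AA>"
  by (simp add: Aut_def permutes_id)

lemma comp_in_Aut:
  assumes "g \<in> Aut \<AA>" "h \<in> Aut \<AA>"
  shows "g \<circ> h \<in> Aut \<AA>"
proof (rule AutI)
  show "g \<circ> h permutes universe \<AA>" using assms Aut_permutes permutes_compose by blast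
  fix s xs assume s: "s \<in> symbols \<AA>" "xs \<in> tuples (universe \<AA>) (arity \<AA> s)"
  then have "map h xs \<in> tuples (universe \<AA>) (arity \<AA> s)"
    using map_in_tuples_iff[OF Aut_permutes[OF assms(2)]] by blast
  then show "map (g \<circ> h) xs \<in> interp \<AA> s \<longleftrightarrow> xs \<in> interp \<AA> s"
    using Aut_interp[OF assms(1) s(1)] Aut_interp[OF assms(2) s] by (simp flip: map_map)
qed

lemma inv_in_Aut:
  assumes "g \<in> Aut \<AA>"
  shows "inv g \<in> Aut \<AA>"
proof (rule AutI)
  have g: "g permutes universe \<AA>" using Aut_permutes[OF assms] .
  show p: "inv g permutes universe \<AA>" using permutes_inv[OF g] .
  fix s xs assume s: "s \<in> symbols \<AA>" "xs \<in> tuples (universe \<AA>) (arity \<AA> s)"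
  have "map g (map (inv g) xs) = xs" using permutes_inverses(1)[OF g] by (simp add: map_idI)
  moreover have "map (inv g) xs \<in> tuples (universe \<AA>) (arity \<AA> s)"
    using s(2) map_in_tuples_iff[OF p] by blast
  ultimately show "map (inv g) xs \<in> interp \<AA> s \<longleftrightarrow> xs \<in> interp \<AA> s"
    using Aut_interp[OF assms s(1)] by metis
qed

text \<open>Each tuple of a relation has finitely many entries, so it only sees a finite part of \<open>f\<close>.\<close>

lemma Aut_closed:
  assumes f: "f permutes universe \<AA>"
    and approx: "\<And>F. finite F \<Longrightarrow> F \<subseteq> universe \<AA> \<Longrightarrow> \<exists>g \<in> Aut \<AA>. \<forall>a \<in> F. g a = f a"
  shows "f \<in> Aut \<AA>"
proof (rule AutI[OF f])
  fix s xs assume s: "s \<in> symbols \<AA>" "xs \<in> tuples (universe \<AA>) (arity \<AA> s)"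
  then obtain g where g: "g \<in> Aut \<AA>" "\<forall>a \<in> set xs. g a = f a"
    using approx[of "set xs"] by (auto simp: tuples_def)
  then have "map f xs = map g xs" by simp
  then show "map f xs \<in> interp \<AA> s \<longleftrightarrow> xs \<in> interp \<AA> s" using Aut_interp[OF g(1) s] by (simp only:)
qed

lemma sat_Aut:
  assumes "g \<in> Aut \<AA>"
  shows "wf_fm \<AA> \<phi> \<Longrightarrow> e ` free_vars \<phi> \<subseteq> universe \<AA> \<Longrightarrow> sat \<AA> (g \<circ> e) \<phi> \<longleftrightarrow> sat \<AA> e \<phi>"
proof (induction \<phi> arbitrary: e)
  case (Eq x y)
  then show ?case using inj_eq[OF permutes_inj[OF Aut_permutes[OF assms]]] by simp
next
  case (Atom s xs)
  then have "map e xs \<in> tuples (universe \<AA>) (arity \<AA> s)" by (auto simp: tuples_def)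
  then have "map g (map e xs) \<in> interp \<AA> s \<longleftrightarrow> map e xs \<in> interp \<AA> s"
    using Aut_interp[OF assms, of s "map e xs"] Atom.prems by simp
  then show ?case by (simp only: sat.simps map_map)
next
  case (Neg \<phi>)
  then show ?case by simp
next
  case (Conj \<phi> \<psi>)
  then show ?case by (simp add: image_Un)
next
  case (Exi x \<phi>)
  have g: "g permutes universe \<AA>" using Aut_permutes[OF assms] .
  have step: "sat \<AA> ((g \<circ> e)(x := g b)) \<phi> \<longleftrightarrow> sat \<AA> (e(x := b)) \<phi>" if "b \<in> universe \<AA>" for b
  proof -
    have "(g \<circ> e)(x := g b) = g \<circ> e(x := b)" by (simp add: fun_upd_comp)
    moreover have "e(x := b) ` free_vars \<phi> \<subseteq> universe \<AA>" using Exi.prems that by auto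
    moreover have "wf_fm \<AA> \<phi>" using Exi.prems by simp
    ultimately show ?thesis using Exi.IH[of "e(x := b)"] by (simp only:)
  qed
  have "(\<exists>a \<in> g ` universe \<AA>. sat \<AA> ((g \<circ> e)(x := a)) \<phi>) \<longleftrightarrow>
      (\<exists>b \<in> universe \<AA>. sat \<AA> ((g \<circ> e)(x := g b)) \<phi>)" by blast
  then show ?case by (simp only: sat.simps permutes_image[OF g] step cong: bex_cong)
qed

lemma Aut_fo_reduct:
  assumes "fo_reduct \<CC> \<AA>"
  shows "Aut \<AA> \<subseteq> Aut \<CC>"
proof
  fix g assume g: "g \<in> Aut \<AA>"
  have U: "universe \<CC> = universe \<AA>" using assms by (simp add: fo_reduct_def)
  have gp: "g permutes universe \<AA>" using Aut_permutes[OF g] .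
  show "g \<in> Aut \<CC>"
  proof (rule AutI)
    show "g permutes universe \<CC>" using gp U by simp
    fix s xs assume s: "s \<in> symbols \<CC>" and "xs \<in> tuples (universe \<CC>) (arity \<CC> s)"
    then have xs: "xs \<in> tuples (universe \<AA>) (arity \<CC> s)" using U by simp
    obtain \<phi> where \<phi>: "wf_fm \<AA> \<phi>" "free_vars \<phi> \<subseteq> {..<arity \<CC> s}"
      and R: "interp \<CC> s = {xs \<in> tuples (universe \<AA>) (arity \<CC> s). sat \<AA> ((!) xs) \<phi>}"
      using assms s unfolding fo_reduct_def fo_definable_def by blast
    have len: "length xs = arity \<CC> s" and sub: "set xs \<subseteq> universe \<AA>" using xs by (auto simp: tuples_def)
    have "sat \<AA> ((!) (map g xs)) \<phi> \<longleftrightarrow> sat \<AA> (g \<circ> (!) xs) \<phi>"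
      using \<phi>(2) len by (intro sat_cong) auto
    also have "\<dots> \<longleftrightarrow> sat \<AA> ((!) xs) \<phi>"
      using \<phi>(2) len sub by (intro sat_Aut[OF g \<phi>(1)]) (force intro: nth_mem)
    finally show "map g xs \<in> interp \<CC> s \<longleftrightarrow> xs \<in> interp \<CC> s"
      using R xs map_in_tuples_iff[OF gp] by simp
  qed
qed

lemma tuples_1: "tuples U (Suc 0) = (\<lambda>b. [b]) ` U"
  by (auto simp: tuples_def length_Suc_conv)

lemma Aut_unary:
  assumes "\<forall>s \<in> symbols \<DD>. arity \<DD> s = 1"
  shows "Aut \<DD> = sort_perms (\<lambda>b. {s \<in> symbols \<DD>. [b] \<in> interp \<DD> s}) (universe \<DD>)"
proof -
  have "Aut \<DD> = {g. g permutes universe \<DD> \<and>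
      (\<forall>s \<in> symbols \<DD>. \<forall>b \<in> universe \<DD>. [g b] \<in> interp \<DD> s \<longleftrightarrow> [b] \<in> interp \<DD> s)}"
    using assms by (simp add: Aut_def tuples_1)
  then show ?thesis unfolding sort_perms_def set_eq_iff by auto
qed

text \<open>
  The sort of \<open>b\<close> is the set of unary predicates that hold at \<open>b\<close>. Interdefinable structures have the
  same automorphisms, and transpositions within a sort show that the orbits are the sorts.
\<close>

lemma U_star_sorts:
  fixes \<BB> :: "('b, 's) rstruct"
  assumes "\<BB> \<in> U_star"
  shows "\<exists>\<kappa> :: 'b \<Rightarrow> nat set. finite (\<kappa> ` universe \<BB>) \<and> Aut \<BB> = sort_perms \<kappa> (universe \<BB>) \<and>
    (\<forall>b \<in> universe \<BB>. {b' \<in> universe \<BB>. \<kappa> b' = \<kappa> b} = {b} \<or>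
      infinite {b' \<in> universe \<BB>. \<kappa> b' = \<kappa> b})"
proof -
  obtain \<DD> :: "('b, nat) rstruct" where \<DD>: "finite_unary_structure \<DD>" "interdefinable \<BB> \<DD>"
    using assms unfolding U_star_def by blast
  let ?\<kappa> = "\<lambda>b. {s \<in> symbols \<DD>. [b] \<in> interp \<DD> s}" and ?B = "universe \<BB>"
  have U: "universe \<DD> = ?B" using \<DD>(2) unfolding interdefinable_def fo_reduct_def by blast
  have "Aut \<BB> = Aut \<DD>"
    using \<DD>(2) Aut_fo_reduct[of \<BB> \<DD>] Aut_fo_reduct[of \<DD> \<BB>] unfolding interdefinable_def by blast
  then have Aut: "Aut \<BB> = sort_perms ?\<kappa> ?B"
    using Aut_unary[of \<DD>] \<DD>(1) U by (simp add: finite_unary_structure_def)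
  have "?\<kappa> ` ?B \<subseteq> Pow (symbols \<DD>)" by blast
  then have fin: "finite (?\<kappa> ` ?B)"
    by (rule finite_subset) (use \<DD>(1) in \<open>simp add: finite_unary_structure_def\<close>)
  have orb: "aut_orbit \<BB> b = {b' \<in> ?B. ?\<kappa> b' = ?\<kappa> b}" if b: "b \<in> ?B" for b
  proof (intro subset_antisym subsetI)
    fix b' assume "b' \<in> aut_orbit \<BB> b"
    then obtain g where "g \<in> sort_perms ?\<kappa> ?B" "b' = g b" using Aut by (auto simp: aut_orbit_def)
    then show "b' \<in> {b' \<in> ?B. ?\<kappa> b' = ?\<kappa> b}" using sort_perms_in sort_perms_sort b by fastforce
  next
    fix b' assume "b' \<in> {b' \<in> ?B. ?\<kappa> b' = ?\<kappa> b}"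
    then have "transpose b b' \<in> Aut \<BB>" using b unfolding Aut by (intro transpose_in_sort_perms) auto
    then show "b' \<in> aut_orbit \<BB> b" unfolding aut_orbit_def mem_Collect_eq
      by (intro exI[of _ "transpose b b'"]) simp
  qed
  have "{b' \<in> ?B. ?\<kappa> b' = ?\<kappa> b} = {b} \<or> infinite {b' \<in> ?B. ?\<kappa> b' = ?\<kappa> b}" if b: "b \<in> ?B" for b
  proof -
    have "b \<in> aut_orbit \<BB> b" using b orb by simp
    moreover have "is_singleton (aut_orbit \<BB> b) \<or> infinite (aut_orbit \<BB> b)"
      using assms b by (simp add: U_star_def)
    ultimately have "aut_orbit \<BB> b = {b} \<or> infinite (aut_orbit \<BB> b)"
      by (auto simp: is_singleton_def)
    then show ?thesis using orb[OF b] by simp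
  qed
  then show ?thesis using Aut fin by (intro exI[of _ ?\<kappa>]) blast
qed

section \<open>Strong splitting\<close>

theorem proposition4p9:
  fixes \<AA> :: "('a, 'r) rstruct" and \<BB> :: "('b, 's) rstruct" and \<pi> :: "'a \<Rightarrow> 'b"
  assumes "\<BB> \<in> U_star" and "finite_cover \<pi> \<AA> \<BB>"
  shows "strongly_split \<pi> \<AA> \<BB>"
proof -
  let ?A = "universe \<AA>" and ?B = "universe \<BB>"
  obtain \<kappa> :: "'b \<Rightarrow> nat set" where \<kappa>: "finite (\<kappa> ` ?B)" "Aut \<BB> = sort_perms \<kappa> ?B"
    "\<And>b. b \<in> ?B \<Longrightarrow> {b' \<in> ?B. \<kappa> b' = \<kappa> b} = {b} \<or> infinite {b' \<in> ?B. \<kappa> b' = \<kappa> b}"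
    using U_star_sorts[OF assms(1)] by blast
  have str: "is_structure \<AA>" "is_structure \<BB>" and onto: "\<pi> ` ?A = ?B"
    and fib: "\<forall>b \<in> ?B. finite (fiber \<pi> ?A b)"
    and pres: "\<And>g. g \<in> Aut \<AA> \<Longrightarrow> preserves_rel g (fiber_eq \<pi> ?A)"
    and img: "mu \<pi> ?A ?B ` Aut \<AA> = Aut \<BB>"
    using assms(2) by (auto simp: finite_cover_def)
  have mu: "mu \<pi> ?A ?B g (\<pi> a) = \<pi> (g a)" if "g \<in> Aut \<AA>" "a \<in> ?A" for g a
    using mu_apply[OF onto pres] that by blast
  interpret sorted_cover ?A ?B \<pi> "Aut \<AA>" \<kappa>
  proof
    show "countable ?B" using assms(1) by (simp add: U_star_def)
    show "f \<in> Aut \<AA>" if "f permutes ?A"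
      "\<And>F. finite F \<Longrightarrow> F \<subseteq> ?A \<Longrightarrow> \<exists>g \<in> Aut \<AA>. \<forall>a \<in> F. g a = f a" for f
      using that by (rule Aut_closed)
    show "\<exists>q \<in> sort_perms \<kappa> ?B. \<forall>a \<in> ?A. \<pi> (g a) = q (\<pi> a)" if g: "g \<in> Aut \<AA>" for g
      using mu[OF g] img g unfolding \<kappa>(2) by (intro bexI[of _ "mu \<pi> ?A ?B g"]) auto
    show "\<exists>g \<in> Aut \<AA>. \<forall>a \<in> ?A. \<pi> (g a) = q (\<pi> a)" if q: "q \<in> sort_perms \<kappa> ?B" for q
    proof -
      obtain g where "g \<in> Aut \<AA>" "q = mu \<pi> ?A ?B g" using q img unfolding \<kappa>(2) by blast
      then show ?thesis using mu by auto
    qed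
  qed (use onto fib \<kappa> id_in_Aut comp_in_Aut inv_in_Aut Aut_permutes in auto)
  obtain l :: "'a \<Rightarrow> 'a" where l: "\<And>a a'. a \<in> ?A \<Longrightarrow> a' \<in> ?A \<Longrightarrow> \<pi> a = \<pi> a' \<Longrightarrow> l a = l a' \<Longrightarrow> a = a'"
    and lift: "\<And>q. q \<in> Aut \<BB> \<Longrightarrow> \<exists>g \<in> Aut \<AA>. \<forall>a \<in> ?A. \<pi> (g a) = q (\<pi> a) \<and> l (g a) = l a"
    using labels_exist unfolding \<kappa>(2) by blast
  \<comment> \<open>All \<open>L\<close>-invariant relations become symbols. The relations of \<open>\<AA>\<close> are among them, and so are
    the sets of points with a given label, which cut the automorphism group down to \<open>L\<close>.\<close>
  define L where "L = {g \<in> Aut \<AA>. \<forall>a \<in> ?A. l (g a) = l a}"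
  define \<AA>' :: "('a, nat \<times> 'a list set) rstruct" where
    "\<AA>' = \<lparr>universe = ?A,
      symbols = {(n, R). R \<subseteq> tuples ?A n \<and>
        (\<forall>g \<in> L. \<forall>xs \<in> tuples ?A n. map g xs \<in> R \<longleftrightarrow> xs \<in> R)},
      arity = fst, interp = snd\<rparr>"
  have str': "is_structure \<AA>'" and U': "universe \<AA>' = ?A" by (auto simp: \<AA>'_def is_structure_def)
  have L_Aut: "L \<subseteq> Aut \<AA>'"
    using Aut_permutes by (auto simp: L_def \<AA>'_def Aut_def)
  have red: "fo_reduct \<AA> \<AA>'"
    unfolding fo_reduct_def
  proof (intro conjI ballI str str')
    show "?A = universe \<AA>'" using U' by simp
    fix s assume s: "s \<in> symbols \<AA>"
    let ?n = "arity \<AA> s" and ?R = "interp \<AA> s"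
    have R: "?R \<subseteq> tuples ?A ?n" using str(1) s by (simp add: is_structure_def)
    then have "(?n, ?R) \<in> symbols \<AA>'" using s Aut_interp by (fastforce simp: \<AA>'_def L_def)
    then have wf: "wf_fm \<AA>' (Atom (?n, ?R) [0..<?n])" by (simp add: \<AA>'_def)
    have "sat \<AA>' ((!) xs) (Atom (?n, ?R) [0..<?n]) \<longleftrightarrow> xs \<in> ?R" if "xs \<in> tuples ?A ?n" for xs
      using that map_nth[of xs] by (simp add: \<AA>'_def tuples_def)
    then have "?R = {xs \<in> tuples (universe \<AA>') ?n. sat \<AA>' ((!) xs) (Atom (?n, ?R) [0..<?n])}"
      using R U' by auto
    then show "fo_definable \<AA>' ?n ?R"
      unfolding fo_definable_def using wf by (intro exI[of _ "Atom (?n, ?R) [0..<?n]"]) auto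
  qed
  have Aut': "Aut \<AA>' = L"
  proof
    show "Aut \<AA>' \<subseteq> L"
    proof
      fix g assume g: "g \<in> Aut \<AA>'"
      then have gA: "g \<in> Aut \<AA>" using Aut_fo_reduct[OF red] by blast
      have "l (g a) = l a" if a: "a \<in> ?A" for a
      proof -
        let ?R = "{[x] | x. x \<in> ?A \<and> l x = l a}"
        have "(1, ?R) \<in> symbols \<AA>'"
          using G_in by (auto simp: \<AA>'_def tuples_def L_def length_Suc_conv)
        then have "map g [a] \<in> ?R \<longleftrightarrow> [a] \<in> ?R"
          using Aut_interp[OF g, of "(1, ?R)" "[a]"] a by (simp add: \<AA>'_def tuples_def)
        then show ?thesis using a by simp
      qed
      then show "g \<in> L" using gA by (simp add: L_def)
    qed
  qed (rule L_Aut)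
  have "mu \<pi> ?A ?B ` L = Aut \<BB>"
  proof
    show "mu \<pi> ?A ?B ` L \<subseteq> Aut \<BB>" using img by (auto simp: L_def)
    show "Aut \<BB> \<subseteq> mu \<pi> ?A ?B ` L"
    proof
      fix q assume q: "q \<in> Aut \<BB>"
      then obtain g where g: "g \<in> Aut \<AA>" "\<And>a. a \<in> ?A \<Longrightarrow> \<pi> (g a) = q (\<pi> a) \<and> l (g a) = l a"
        using lift by blast
      have "mu \<pi> ?A ?B g b = q b" for b
      proof (cases "b \<in> ?B")
        case True
        then obtain a where "a \<in> ?A" "b = \<pi> a" using onto by blast
        then show ?thesis using mu[OF g(1)] g(2) by simp
      next
        case False
        then show ?thesis using permutes_not_in[OF Aut_permutes[OF q]] by (simp add: mu_def)
      qed
      then have "mu \<pi> ?A ?B g = q" by blast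
      then show "q \<in> mu \<pi> ?A ?B ` L" using g by (auto simp: L_def)
    qed
  qed
  then have cover': "finite_cover \<pi> \<AA>' \<BB>"
    using str str' onto fib pres by (simp add: finite_cover_def U' Aut' L_def)
  moreover have "fiber_group \<pi> \<AA>' b = {id}" if "b \<in> ?B" for b
  proof -
    let ?S = "fiber \<pi> ?A b"
    have "perm_restrict g ?S = id" if g: "g \<in> L" "g ` ?S = ?S" for g
    proof
      fix a
      have "g a = a" if a: "a \<in> ?S"
      proof -
        have "g a \<in> ?S" using g(2) a by blast
        then show ?thesis using l[of "g a" a] a g(1) by (auto simp: fiber_def L_def)
      qed
      then show "perm_restrict g ?S a = id a" by (simp add: perm_restrict_def)
    qed
    then have "fiber_group \<pi> \<AA>' b \<subseteq> {id}" unfolding fiber_group_def Let_def U' Aut' by blast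
    moreover have "id \<in> L" using id_in_Aut by (simp add: L_def)
    then have "perm_restrict id ?S \<in> fiber_group \<pi> \<AA>' b"
      unfolding fiber_group_def Let_def U' Aut' by (intro CollectI exI[of _ id]) simp
    ultimately show ?thesis by (metis empty_iff subset_singletonD)
  qed
  ultimately have "strongly_trivial_cover \<pi> \<AA>' \<BB>" by (simp add: strongly_trivial_cover_def)
  moreover have "covering_reduct \<pi> \<AA> \<AA>' \<BB>"
    using cover' red pres img by (auto simp: covering_reduct_def)
  ultimately show ?thesis using assms(2) U' unfolding strongly_split_def by blast
qed

end
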